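(* Let $d\ge 1$. A simplicial complex $\Delta\subseteq 2^{[n]}$ is weakly $d$-Tverberg if and only if it is $d$-colorfully representable.
   Context: A word is a finite sequence of letters from an alphabet; a subword is obtained by deleting some (possibly none) of the letter occurrences. For $\sigma\subseteq[n]$ with $|\sigma|=r\ge 2$, a $d$-colorful word on alphabet $\sigma$ is a word $W$ of length $(d+1)(r-1)+1$ such that for every $i\in[d+1]$, the segment of $W$ at positions $(i-1)(r-1)+1$ through $i(r-1)+1$ (inclusive) contains every letter of $\sigma$ exactly once. A simplicial complex $\Delta\subseteq 2^{[n]}$ is $d$-colorfully representable if there is a word $W$ on alphabet $[n]$ such that for every $\sigma\subseteq[n]$ (with $|\sigma|\ge 2$, colorful words being defined only for such $\sigma$), $\sigma\in\Delta$ iff $W$ contains a $d$-colorful subword on alphabet $\sigma$. A finite set $P\subseteq\mathbb{R}^d$ is in general position if for every $k\le d+1$ no $k$ points of $P$ lie on a common $(k-2)$-dimensional affine subspace. $\Delta$ is partition induced on a finite $P\subseteq\mathbb{R}^d$ if there is a partition $\{P_1,\dots,P_n\}$ of $P$ such that for all $\sigma\subseteq[n]$, $\bigcap_{i\in\sigma}\mathrm{conv}(P_i)\ne\emptyset$ iff $\sigma\in\Delta$. $\Delta$ is weakly $d$-Tverberg if there is a constant $C$ such that for every point set $P\subseteq\mathbb{R}^d$ in general position with at least $C$ points, $\Delta$ is partition induced on some subset of $P$. *)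

theory Defs
  imports "HOL-Analysis.Analysis" "HOL-Library.Sublist"
begin

text \<open>Vertices \<open>i\<close> with \<open>{i} \<notin> \<Delta>\<close> are allowed. The empty face is required, which excludes only
  the void complex \<open>\<Delta> = {}\<close>.\<close>

definition simplicial_complex_on :: "nat \<Rightarrow> nat set set \<Rightarrow> bool" where
  "simplicial_complex_on n \<Delta> \<longleftrightarrow>
     \<Delta> \<subseteq> Pow {1..n} \<and> {} \<in> \<Delta> \<and> (\<forall>\<sigma>\<in>\<Delta>. \<forall>\<tau>. \<tau> \<subseteq> \<sigma> \<longrightarrow> \<tau> \<in> \<Delta>)"

text \<open>Lists are indexed from 0, so positions \<open>(i - 1) * (r - 1) + 1\<close> through \<open>i * (r - 1) + 1\<close>
  (counted from 1) are the \<open>r\<close> entries that remain at the front after dropping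
  \<open>(i - 1) * (r - 1)\<close>; consecutive segments share one entry. This is meaningful only for
  \<open>card \<sigma> \<ge> 2\<close>, a condition imposed where the definition is used.\<close>

definition colorful_word :: "nat \<Rightarrow> nat set \<Rightarrow> nat list \<Rightarrow> bool" where
  "colorful_word d \<sigma> W \<longleftrightarrow>
     set W \<subseteq> \<sigma> \<and>
     length W = (d + 1) * (card \<sigma> - 1) + 1 \<and>
     (\<forall>i\<in>{1..d + 1}. \<forall>a\<in>\<sigma>.
        count_list (take (card \<sigma>) (drop ((i - 1) * (card \<sigma> - 1)) W)) a = 1)"

definition colorfully_representable :: "nat \<Rightarrow> nat \<Rightarrow> nat set set \<Rightarrow> bool" where
  "colorfully_representable d n \<Delta> \<longleftrightarrow>
     (\<exists>W. set W \<subseteq> {1..n} \<and>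
        (\<forall>\<sigma>. \<sigma> \<subseteq> {1..n} \<and> card \<sigma> \<ge> 2 \<longrightarrow>
           (\<sigma> \<in> \<Delta> \<longleftrightarrow> (\<exists>V. subseq V W \<and> colorful_word d \<sigma> V))))"

text \<open>The dimension \<open>k - 2\<close> is an integer; \<open>aff_dim {} = - 1\<close>, so the cases \<open>k = 0\<close> and
  \<open>k = 1\<close> impose no condition.\<close>

definition general_position :: "(real ^ 'd) set \<Rightarrow> bool" where
  "general_position P \<longleftrightarrow>
     finite P \<and>
     (\<forall>k \<le> CARD('d) + 1. \<forall>S. S \<subseteq> P \<and> card S = k \<longrightarrow>
        \<not> (\<exists>A. affine A \<and> aff_dim A = int k - 2 \<and> S \<subseteq> A))"

text \<open>The intersection over \<open>\<sigma> = {}\<close> is the whole space. Nonemptiness of the parts is not a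
  separate requirement: \<open>\<sigma> = {i}\<close> forces \<open>Q i\<close> to be nonempty exactly when \<open>{i} \<in> \<Delta>\<close>. So if
  every \<open>i \<in> {1..n}\<close> is a vertex of \<open>\<Delta>\<close>, this is a partition in the usual sense, and
  otherwise the non-vertices have empty parts.\<close>

definition partition_induced_on :: "nat \<Rightarrow> nat set set \<Rightarrow> (real ^ 'd) set \<Rightarrow> bool" where
  "partition_induced_on n \<Delta> P \<longleftrightarrow>
     (\<exists>Q. (\<Union>i\<in>{1..n}. Q i) = P \<and> disjoint_family_on Q {1..n} \<and>
        (\<forall>\<sigma>. \<sigma> \<subseteq> {1..n} \<longrightarrow> ((\<Inter>i\<in>\<sigma>. convex hull (Q i)) \<noteq> {} \<longleftrightarrow> \<sigma> \<in> \<Delta>)))"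

text \<open>The ambient space is \<open>real ^ 'd\<close>, passed as a type argument; its dimension is
  \<open>CARD('d) \<ge> 1\<close>.\<close>

definition weakly_Tverberg :: "'d::finite itself \<Rightarrow> nat \<Rightarrow> nat set set \<Rightarrow> bool" where
  "weakly_Tverberg (_ :: 'd itself) n \<Delta> \<longleftrightarrow>
     (\<exists>C. \<forall>P :: (real ^ 'd) set. general_position P \<and> card P \<ge> C \<longrightarrow>
        (\<exists>P' \<subseteq> P. partition_induced_on n \<Delta> P'))"

end

theory Submission
  imports Defs "HOL-Library.Ramsey" "HOL-Computational_Algebra.Polynomial"
begin

text \<open>Call a sequence of points stretched if \<open>d + 1\<close> positive affine functions \<open>f j\<close>, spanning all
  affine functions, are such that each quotient \<open>f (j + 1) / f j\<close> grows by a huge factor \<open>K\<close> from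
  each point to the next. For a stretched sequence the sum \<open>f j z = (\<Sum>i. w i * f j (p i))\<close> is governed
  by one summand, and a comparison of the dominant summands for all \<open>j\<close> and all parts shows that a
  point common to the convex hulls of the parts produces a colorful subword. Conversely, a colorful
  subword excludes a certificate of disjointness of the hulls (affine functions summing to zero,
  each nonnegative on its part), because the coefficients of these functions with respect to the
  \<open>f j\<close> would be forced to be negligible against their maximum.

  Every large set in general position contains a long stretched sequence: by Ramsey's theorem all
  increasing tuples may be assumed to have the same orientation, and to agree on which cross ratios
  of four vectors modulo the others are at most \<open>1/2\<close>; the Pluecker relation leaves only the
  case that all of them are, and cross ratios multiply when intermediate points are skipped.
  So the complexes induced on subsets of a stretched sequence are exactly the colorfully
  representable ones.\<close>

section \<open>Colorful subwords and chains of intervals\<close>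

text \<open>The mediating notion is a chain of \<open>D = d + 1\<close> intervals of positions,
  neighbours sharing an end, each containing all letters of \<sigma>. Interval \<open>s\<close>
  belongs to the function \<open>f s\<close>. A common point yields only the weak form
  \<open>covering_chain\<close>, while its construction starts from the exact form
  \<open>rainbow_chain\<close>; the passage between the two is purely combinatorial.

  At a shared end two of the functions have equal size after scaling, so there a certificate is
  controlled only through the sum of two coefficients. This is the obstacle in the converse:
  carrying the control through all intervals costs the power \<open>(N + 1) ^ (3 * D)\<close> in the
  bound on \<open>K\<close>. The other bound \<open>(real N)\<^sup>2\<close> comes from replacing a
  sum by \<open>N\<close> times its largest summand, twice.

  Colorful words say nothing about singletons, whereas the parts of a partition must be nonempty
  exactly for the vertices. A representing word is therefore normalised first. In the other
  direction the weak Tverberg property is applied to a stretched set itself, whose subsets are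
  stretched again.\<close>

lemma subseq_iff_indices:
  "subseq V W \<longleftrightarrow>
     (\<exists>G. sorted_wrt (<) G \<and> set G \<subseteq> {..<length W} \<and> V = map ((!) W) G)"
proof
  assume "subseq V W"
  then obtain I where "V = nths W I" by (auto simp: subseq_conv_nths)
  also have "\<dots> = map ((!) W) (nths [0..<length W] I)"
    by (metis map_nth nths_map)
  finally have V: "V = map ((!) W) (nths [0..<length W] I)" .
  moreover have "sorted_wrt (<) (nths [0..<length W] I)"
    by (simp add: strict_sorted_iff sorted_nths)
  moreover have "set (nths [0..<length W] I) \<subseteq> {..<length W}"
    using set_nths_subset[of "[0..<length W]" I] by auto
  ultimately show "\<exists>G. sorted_wrt (<) G \<and> set G \<subseteq> {..<length W} \<and> V = map ((!) W) G"
    by blast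
next
  assume "\<exists>G. sorted_wrt (<) G \<and> set G \<subseteq> {..<length W} \<and> V = map ((!) W) G"
  then obtain G where G: "sorted_wrt (<) G" "set G \<subseteq> {..<length W}" "V = map ((!) W) G" by blast
  have "subseq G [0..<length W]"
    using G by (intro sorted_subset_imp_subseq) (auto simp: strict_sorted_iff)
  then have "subseq (map ((!) W) G) (map ((!) W) [0..<length W])" by (rule subseq_map)
  then show "subseq V W" using G(3) by (simp add: map_nth)
qed

text \<open>The bound \<open>k < length W\<close> keeps unspecified values of \<open>(!)\<close>
  out, so that chain ends may be arbitrary numbers.\<close>

definition letters_between :: "nat list \<Rightarrow> nat \<Rightarrow> nat \<Rightarrow> nat set" where
  "letters_between W a b = {W ! k | k. a \<le> k \<and> k \<le> b \<and> k < length W}"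

definition covering_chain :: "nat \<Rightarrow> nat set \<Rightarrow> nat list \<Rightarrow> (nat \<Rightarrow> nat) \<Rightarrow> bool" where
  "covering_chain D \<sigma> W e \<longleftrightarrow> (\<forall>s<D. \<sigma> \<subseteq> letters_between W (e s) (e (Suc s)))"

text \<open>A colorful subword in terms of positions: \<open>ix s c\<close> is the position chosen
  for the letter \<open>c\<close> in segment \<open>s\<close>. The last two equations make adjacent
  segments choose the same position for the letter at their common end.\<close>

definition rainbow_chain ::
    "nat \<Rightarrow> nat set \<Rightarrow> nat list \<Rightarrow> (nat \<Rightarrow> nat) \<Rightarrow> (nat \<Rightarrow> nat \<Rightarrow> nat) \<Rightarrow> bool" where
  "rainbow_chain D \<sigma> W E ix \<longleftrightarrow>
     (\<forall>s\<le>D. E s < length W \<and> W ! E s \<in> \<sigma>) \<and>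
     (\<forall>s<D. E s < E (Suc s) \<and>
        (\<forall>c\<in>\<sigma>. W ! ix s c = c \<and> E s \<le> ix s c \<and> ix s c \<le> E (Suc s)) \<and>
        ix s (W ! E s) = E s \<and> ix s (W ! E (Suc s)) = E (Suc s))"

lemma covering_chain_if_colorful:
  assumes V: "subseq V W" "colorful_word d \<sigma> V" and r: "card \<sigma> \<ge> 2"
  shows "\<exists>e. covering_chain (Suc d) \<sigma> W e"
proof -
  obtain G where G: "sorted_wrt (<) G" "set G \<subseteq> {..<length W}" "V = map ((!) W) G"
    using V(1) subseq_iff_indices by blast
  define m where "m = card \<sigma> - 1"
  have lenG: "length G = Suc d * m + 1"
    using V(2) G(3) by (simp add: colorful_word_def m_def)
  have "\<sigma> \<subseteq> letters_between W (G ! (s * m)) (G ! (Suc s * m))" if s: "s < Suc d" for s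
  proof
    fix c assume c: "c \<in> \<sigma>"
    have "\<forall>i\<in>{1..d + 1}. \<forall>a\<in>\<sigma>. count_list (take (card \<sigma>) (drop ((i - 1) * m) V)) a = 1"
      using V(2) by (auto simp: colorful_word_def m_def)
    from bspec[OF bspec[OF this, of "Suc s"] c] s
    have "count_list (take (card \<sigma>) (drop (s * m) V)) c = 1" by simp
    then have "c \<in> set (take (card \<sigma>) (drop (s * m) V))"
      by (metis count_notin zero_neq_one)
    then obtain t where t: "t < length (take (card \<sigma>) (drop (s * m) V))"
      "take (card \<sigma>) (drop (s * m) V) ! t = c" by (auto simp: in_set_conv_nth)
    have tm: "t \<le> m" using t(1) r unfolding m_def by auto
    have "Suc s * m \<le> Suc d * m" using s by (intro mult_le_mono1) simp
    then have le: "Suc s * m < length G" using lenG by linarith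
    have le2: "s * m + t \<le> Suc s * m" using tm by simp
    have lt: "s * m + t < length G" using le le2 by linarith
    have "V ! (s * m + t) = c" using t lt G(3) by (simp add: nth_append)
    then have "W ! (G ! (s * m + t)) = c" using G(3) lt by simp
    moreover have "G ! (s * m + t) \<in> set G" using lt by simp
    moreover have "G ! (s * m) \<le> G ! (s * m + t)"
      using sorted_nth_mono[of G "s * m" "s * m + t"] lt G(1) by (simp add: strict_sorted_iff)
    moreover have "G ! (s * m + t) \<le> G ! (Suc s * m)"
      using sorted_nth_mono[of G "s * m + t" "Suc s * m"] le le2 G(1) by (simp add: strict_sorted_iff)
    ultimately show "c \<in> letters_between W (G ! (s * m)) (G ! (Suc s * m))"
      unfolding letters_between_def using G(2) by blast
  qed
  then show ?thesis unfolding covering_chain_def by (intro exI[of _ "\<lambda>s. G ! (s * m)"]) blast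
qed

text \<open>Taking each interval as short as possible makes its last letter occur only at its right end,
  which is what lets consecutive rainbow segments share exactly one position.\<close>

lemma rainbow_chain_if_covering_chain:
  assumes e: "covering_chain D \<sigma> W e" and r: "card \<sigma> \<ge> 2" and D: "D \<ge> 1"
  shows "\<exists>E ix. rainbow_chain D \<sigma> W E ix"
proof -
  have ne: "\<sigma> \<noteq> {}" using r by auto
  \<comment> \<open>Greedy choice: each right end is as far left as possible. It never passes the
    corresponding end of \<open>e\<close>, so every later interval of \<open>e\<close> stays
    available.\<close>
  define E where "E = rec_nat (LEAST k. e 0 \<le> k \<and> k < length W \<and> W ! k \<in> \<sigma>)
    (\<lambda>_ a. LEAST m. \<sigma> \<subseteq> letters_between W a m)"
  have E0: "E 0 = (LEAST k. e 0 \<le> k \<and> k < length W \<and> W ! k \<in> \<sigma>)"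
    and ES: "E (Suc s) = (LEAST m. \<sigma> \<subseteq> letters_between W (E s) m)" for s
    by (simp_all add: E_def)
  have cov0: "\<sigma> \<subseteq> letters_between W (e 0) (e 1)"
    using e D by (force simp: covering_chain_def)
  have "\<exists>k. e 0 \<le> k \<and> k < length W \<and> W ! k \<in> \<sigma>"
    using cov0 ne unfolding letters_between_def by blast
  from LeastI_ex[OF this] have E0p: "e 0 \<le> E 0 \<and> E 0 < length W \<and> W ! E 0 \<in> \<sigma>"
    unfolding E0 .
  have E0l: "E 0 \<le> k" if "e 0 \<le> k" "k < length W" "W ! k \<in> \<sigma>" for k
    unfolding E0 using that by (intro Least_le) simp
  have cov: "E s < length W \<and> W ! E s \<in> \<sigma> \<and> (s < D \<longrightarrow> \<sigma> \<subseteq> letters_between W (E s) (e (Suc s)))"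
    if "s \<le> D" for s using that
  proof (induction s)
    case 0
    have "\<sigma> \<subseteq> letters_between W (E 0) (e 1)"
      using cov0 E0l unfolding letters_between_def by blast
    then show ?case using E0p by simp
  next
    case (Suc s)
    then have c: "\<sigma> \<subseteq> letters_between W (E s) (e (Suc s))" by simp
    then have c': "\<sigma> \<subseteq> letters_between W (E s) (E (Suc s))" unfolding ES by (rule LeastI)
    have le: "E (Suc s) \<le> e (Suc s)" unfolding ES using c by (rule Least_le)
    have min: "\<not> \<sigma> \<subseteq> letters_between W (E s) m" if "m < E (Suc s)" for m
      using not_less_Least that unfolding ES by blast
    \<comment> \<open>Positivity makes \<open>E (Suc s) - 1\<close> a true predecessor. By
      minimality some letter is lost there, and its occurrence must sit exactly at
      \<open>E (Suc s)\<close>.\<close>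
    have pos: "E (Suc s) > 0"
    proof (rule ccontr)
      assume "\<not> ?thesis"
      then have "\<sigma> \<subseteq> {W ! 0}" using c' by (auto simp: letters_between_def)
      then show False using card_mono[of "{W ! 0}" \<sigma>] r by simp
    qed
    then obtain c where "c \<in> \<sigma>" "c \<notin> letters_between W (E s) (E (Suc s) - 1)"
      using min[of "E (Suc s) - 1"] by auto
    moreover obtain k where "W ! k = c" "E s \<le> k" "k \<le> E (Suc s)" "k < length W"
      using c' \<open>c \<in> \<sigma>\<close> by (auto simp: letters_between_def)
    ultimately have "k = E (Suc s)" 
      by (metis (mono_tags, lifting) One_nat_def Suc_pred letters_between_def le_SucE mem_Collect_eq pos)
    moreover have "\<sigma> \<subseteq> letters_between W (E (Suc s)) (e (Suc (Suc s)))" if "Suc s < D"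
    proof -
      have "\<sigma> \<subseteq> letters_between W (e (Suc s)) (e (Suc (Suc s)))"
        using e that unfolding covering_chain_def by blast
      then show ?thesis using le unfolding letters_between_def by fastforce
    qed
    ultimately show ?case using \<open>c \<in> \<sigma>\<close> \<open>W ! k = c\<close> \<open>k < length W\<close> by blast
  qed
  have cS: "\<sigma> \<subseteq> letters_between W (E s) (E (Suc s))" if "s < D" for s
    unfolding ES using cov[of s] that by (metis LeastI less_imp_le)
  have min: "\<not> \<sigma> \<subseteq> letters_between W (E s) m" if "m < E (Suc s)" for s m
    using not_less_Least[OF that[unfolded ES]] .
  have lt: "E s < E (Suc s)" if "s < D" for s
  proof (rule ccontr)
    assume "\<not> ?thesis"
    then have "letters_between W (E s) (E (Suc s)) \<subseteq> {W ! E s}"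
      unfolding letters_between_def using le_antisym le_trans not_less by blast
    then have "\<sigma> \<subseteq> {W ! E s}" using cS[OF that] by blast
    then show False using card_mono[of "{W ! E s}" \<sigma>] r by simp
  qed
  have last: "k = E (Suc s)" if s: "s < D" and k: "E s \<le> k" "k \<le> E (Suc s)" "W ! k = W ! E (Suc s)" for s k
  proof (rule ccontr)
    assume "k \<noteq> E (Suc s)"
    then have k': "k < E (Suc s)" using k by simp
    have "letters_between W (E s) (E (Suc s)) \<subseteq> letters_between W (E s) (E (Suc s) - 1)"
    proof
      fix x assume "x \<in> letters_between W (E s) (E (Suc s))"
      then obtain l where l: "x = W ! l" "E s \<le> l" "l \<le> E (Suc s)" "l < length W"
        by (auto simp: letters_between_def)
      define l' where "l' = (if l = E (Suc s) then k else l)"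
      have "x = W ! l' \<and> E s \<le> l' \<and> l' \<le> E (Suc s) - 1 \<and> l' < length W"
        using l k k' by (auto simp: l'_def)
      then show "x \<in> letters_between W (E s) (E (Suc s) - 1)" unfolding letters_between_def by blast
    qed
    then show False using cS[OF s] min[of "E (Suc s) - 1" s] k' by auto
  qed
  \<comment> \<open>Only the left end has to be forced: by \<open>last\<close>, the letter of the
    right end has no other position in the interval.\<close>
  define ix where "ix = (\<lambda>s c. if c = W ! E s then E s
    else SOME k. E s \<le> k \<and> k \<le> E (Suc s) \<and> W ! k = c)"
  have ix: "W ! ix s c = c \<and> E s \<le> ix s c \<and> ix s c \<le> E (Suc s)" if "s < D" "c \<in> \<sigma>" for s c
  proof (cases "c = W ! E s")
    case True then show ?thesis using lt[OF that(1)] by (simp add: ix_def)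
  next
    case False
    have "\<exists>k. E s \<le> k \<and> k \<le> E (Suc s) \<and> W ! k = c"
      using cS[OF that(1)] that(2) by (auto simp: letters_between_def)
    from someI_ex[OF this] False show ?thesis by (simp add: ix_def)
  qed
  have "rainbow_chain D \<sigma> W E ix"
    unfolding rainbow_chain_def
  proof (intro conjI allI impI ballI)
    fix s assume s: "s < D"
    show "ix s (W ! E (Suc s)) = E (Suc s)"
      using ix[OF s, of "W ! E (Suc s)"] cov[of "Suc s"] s by (intro last) auto
    show "ix s (W ! E s) = E s" by (simp add: ix_def)
  qed (use cov lt ix in auto)
  then show ?thesis by blast
qed

text \<open>The positions are collected from the last segment backwards; \<open>hd G = E s\<close>
  is the invariant that glues a new block to the list already built.\<close>

lemma colorful_if_rainbow_chain:
  assumes rc: "rainbow_chain (Suc d) \<sigma> W E ix" and r: "card \<sigma> \<ge> 2"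
  shows "\<exists>V. subseq V W \<and> colorful_word d \<sigma> V"
proof -
  have fin: "finite \<sigma>" using r card.infinite by fastforce
  define m where "m = card \<sigma> - 1"
  have cm: "card \<sigma> = Suc m" using r by (simp add: m_def)
  have rcE: "E s < length W" "W ! E s \<in> \<sigma>" if "s \<le> Suc d" for s
    using rc that unfolding rainbow_chain_def by blast+
  have rcI: "E s < E (Suc s)" "ix s (W ! E s) = E s" "ix s (W ! E (Suc s)) = E (Suc s)"
    if "s < Suc d" for s
    using rc that unfolding rainbow_chain_def by blast+
  have ix: "W ! ix s c = c" "E s \<le> ix s c" "ix s c \<le> E (Suc s)" if "s < Suc d" "c \<in> \<sigma>" for s c
    using rc that unfolding rainbow_chain_def by blast+
  have "\<exists>G. sorted_wrt (<) G \<and> set G \<subseteq> {E s..<length W} \<and> G \<noteq> [] \<and> hd G = E s \<and>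
          length G = t * m + 1 \<and> (!) W ` set G \<subseteq> \<sigma> \<and>
          (\<forall>j<t. \<forall>c\<in>\<sigma>. count_list (take (card \<sigma>) (drop (j * m) (map ((!) W) G))) c = 1)"
    if "s + t = Suc d" for s t using that
  proof (induction t arbitrary: s)
    case 0
    then show ?case using rcE[of s] by (intro exI[of _ "[E s]"]) auto
  next
    case (Suc t)
    then have s: "s < Suc d" by simp
    have "Suc s + t = Suc d" using Suc.prems by simp
    from Suc.IH[OF this] obtain G where G: "sorted_wrt (<) G" "set G \<subseteq> {E (Suc s)..<length W}"
      "G \<noteq> []" "hd G = E (Suc s)" "length G = t * m + 1" "(!) W ` set G \<subseteq> \<sigma>"
      and cnt: "\<forall>j<t. \<forall>c\<in>\<sigma>.
        count_list (take (card \<sigma>) (drop (j * m) (map ((!) W) G))) c = 1"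
      by (elim exE conjE)
    note ix = ix[OF s]
    have Es: "W ! E s \<in> \<sigma>" "W ! E (Suc s) \<in> \<sigma>" "ix s (W ! E s) = E s"
      "ix s (W ! E (Suc s)) = E (Suc s)" "E s < E (Suc s)" "E (Suc s) < length W"
      using rcE[of s] rcE[of "Suc s"] rcI[OF s] s by simp_all
    have inj: "inj_on (ix s) \<sigma>" using ix(1) by (metis inj_onI)
    \<comment> \<open>The right end is left out because it is already the head of
      \<open>G\<close>.\<close>
    define A where "A = ix s ` (\<sigma> - {W ! E (Suc s)})"
    have A: "a \<ge> E s \<and> a < E (Suc s) \<and> W ! a \<in> \<sigma> - {W ! E (Suc s)}" if "a \<in> A" for a
    proof -
      obtain c where c: "c \<in> \<sigma>" "c \<noteq> W ! E (Suc s)" "a = ix s c" using \<open>a \<in> A\<close> by (auto simp: A_def)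
      have "W ! a = c" using c ix by simp
      then have "a \<noteq> E (Suc s)" using c(2) by auto
      then show ?thesis using c ix[OF c(1)] by auto
    qed
    have finA: "finite A" using fin by (simp add: A_def)
    have cardA: "card A = m"
      unfolding A_def using inj fin Es(2) cm
      by (subst card_image) (auto intro: inj_on_subset)
    have "W ! E s \<noteq> W ! E (Suc s)" using Es by auto
    then have EsA: "E s \<in> A" using Es by (force simp: A_def)
    define L where "L = sorted_list_of_set A"
    have L: "set L = A" "sorted_wrt (<) L" "length L = m" "distinct L"
      using finA cardA by (auto simp: L_def)
    have L0: "L \<noteq> []" using L EsA by auto
    have hdL: "hd L = E s"
    proof (rule antisym)
      have "sorted L" using L(2) by (simp add: strict_sorted_iff)
      then have "hd L \<le> x" if "x \<in> set L" for x using that by (cases L) auto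
      then show "hd L \<le> E s" using EsA L(1) by blast
      have "hd L \<in> A" using L0 L(1) hd_in_set by blast
      then show "E s \<le> hd L" using A by blast
    qed
    define WL where "WL = map ((!) W) (L @ [E (Suc s)])"
    have WL: "count_list WL c = 1" if "c \<in> \<sigma>" for c
    proof -
      have inj: "inj_on ((!) W) (set (L @ [E (Suc s)]))"
      proof (rule inj_onI)
        fix a b assume a: "a \<in> set (L @ [E (Suc s)])" "b \<in> set (L @ [E (Suc s)])" "W ! a = W ! b"
        have "ix s (W ! x) = x" if "x \<in> set (L @ [E (Suc s)])" for x
          using that L(1) Es ix unfolding A_def by auto
        then show "a = b" using a by metis
      qed
      have "distinct (L @ [E (Suc s)])" using L A by auto
      then have dist: "distinct WL" unfolding WL_def using inj by (simp add: distinct_map)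
      have "c \<in> set WL"
      proof (cases "c = W ! E (Suc s)")
        case False
        then have "ix s c \<in> set L" using L(1) that by (auto simp: A_def)
        then show ?thesis using ix(1)[OF that] unfolding WL_def by (metis UnCI image_eqI set_append set_map)
      qed (simp add: WL_def)
      then show ?thesis using dist by (simp add: count_list_eq_length_filter distinct_length_filter Int_absorb1)
    qed
    have G1: "G = E (Suc s) # tl G" using G(3,4) by (metis list.collapse)
    show ?case
    proof (intro exI[of _ "L @ G"] conjI allI impI ballI)
      show "sorted_wrt (<) (L @ G)" 
      proof -
        have "x < y" if "x \<in> set L" "y \<in> set G" for x y
        proof -
          have "x < E (Suc s)" using that(1) L(1) A by blast
          also have "E (Suc s) \<le> y" using that(2) G(2) by auto
          finally show ?thesis .
        qed
        then show ?thesis using L(2) G(1) by (simp add: sorted_wrt_append)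
      qed
      show "set (L @ G) \<subseteq> {E s..<length W}" 
      proof -
        have "x \<in> {E s..<length W}" if "x \<in> A" for x using A[OF that] Es(6) by simp
        moreover have "x \<in> {E s..<length W}" if "x \<in> set G" for x
        proof -
          have "x \<in> {E (Suc s)..<length W}" using that G(2) by blast
          then show ?thesis using Es(5) by simp
        qed
        ultimately show ?thesis using L(1) by auto
      qed
      show "hd (L @ G) = E s" using hdL L0 by simp
      show "length (L @ G) = Suc t * m + 1" using L G by simp
      show "(!) W ` set (L @ G) \<subseteq> \<sigma>" using L(1) A G(6) by auto
      fix j c assume j: "j < Suc t" and c: "c \<in> \<sigma>"
      show "count_list (take (card \<sigma>) (drop (j * m) (map ((!) W) (L @ G)))) c = 1"
      proof (cases j)
        case 0
        have "take (card \<sigma>) (map ((!) W) (L @ G)) = WL"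
          using L(3) cm by (subst G1) (simp add: WL_def)
        then show ?thesis using 0 WL[OF c] by simp
      next
        case (Suc j')
        have "drop (j * m) (map ((!) W) (L @ G)) = drop (j' * m) (map ((!) W) G)"
          using L(3) Suc by simp
        then show ?thesis using cnt j Suc c by simp
      qed
    qed (use G in simp)
  qed
  from this[of 0 "Suc d", OF add_0] obtain G where G: "sorted_wrt (<) G"
    "set G \<subseteq> {E 0..<length W}" "length G = Suc d * m + 1" "(!) W ` set G \<subseteq> \<sigma>"
    and cnt: "\<forall>j<Suc d. \<forall>c\<in>\<sigma>.
      count_list (take (card \<sigma>) (drop (j * m) (map ((!) W) G))) c = 1"
    by (elim exE conjE)
  have "colorful_word d \<sigma> (map ((!) W) G)"
    unfolding colorful_word_def
  proof (intro conjI ballI)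
    show "set (map ((!) W) G) \<subseteq> \<sigma>" using G(4) by simp
    show "length (map ((!) W) G) = (d + 1) * (card \<sigma> - 1) + 1" using G(3) by (simp add: m_def)
    show "count_list (take (card \<sigma>) (drop ((i - 1) * (card \<sigma> - 1)) (map ((!) W) G))) c = 1"
      if "i \<in> {1..d + 1}" "c \<in> \<sigma>" for i c
      using cnt[rule_format, of "i - 1" c] that unfolding m_def by auto
  qed
  moreover have "subseq (map ((!) W) G) W" unfolding subseq_iff_indices using G by (intro exI[of _ G]) auto
  ultimately show ?thesis by blast
qed

section \<open>Stretched point sequences\<close>

text \<open>The certificate comes from a point minimising the sum of the squared distances to the sets:
  such a point is the mean of its projections.\<close>

lemma disjoint_convex_sets_certificate:
  fixes C :: "'c \<Rightarrow> 'a::euclidean_space set"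
  assumes fin: "finite \<sigma>" and ne: "\<sigma> \<noteq> {}"
    and C: "\<And>c. c \<in> \<sigma> \<Longrightarrow> compact (C c) \<and> convex (C c) \<and> C c \<noteq> {}"
    and empty: "(\<Inter>c\<in>\<sigma>. C c) = {}"
  obtains v x where "(\<Sum>c\<in>\<sigma>. v c) = 0" "\<forall>c\<in>\<sigma>. \<forall>z\<in>C c. 0 \<le> v c \<bullet> (z - x)"
    "\<exists>c\<in>\<sigma>. v c \<noteq> 0"
proof -
  \<comment> \<open>Compactness of \<open>S\<close> provides a minimiser, and the mean
    \<open>m\<close> of the projections lies in \<open>S\<close>, so it is an admissible
    competitor.\<close>
  define S where "S = convex hull (\<Union>c\<in>\<sigma>. C c)"
  define q where "q = (\<lambda>c x. closest_point (C c) x)"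
  define \<Phi> where "\<Phi> = (\<lambda>x. \<Sum>c\<in>\<sigma>. (norm (x - q c x))\<^sup>2)"
  have q: "q c x \<in> C c" "\<And>z. z \<in> C c \<Longrightarrow> norm (x - q c x) \<le> norm (x - z)" if "c \<in> \<sigma>" for c x
    using closest_point_exists[of "C c" x] C[OF that] by (auto simp: q_def dist_norm compact_imp_closed)
  have "compact S" unfolding S_def using fin C by (intro compact_convex_hull compact_UN) auto
  moreover have "S \<noteq> {}" using ne C by (auto simp: S_def)
  moreover have "continuous_on S \<Phi>" unfolding \<Phi>_def q_def using C
    by (intro continuous_intros continuous_on_closest_point) (auto simp: compact_imp_closed)
  ultimately obtain x where x: "x \<in> S" "\<And>y. y \<in> S \<Longrightarrow> \<Phi> x \<le> \<Phi> y"
    using continuous_attains_inf[of S \<Phi>] by blast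
  define r where "r = real (card \<sigma>)"
  have r: "r > 0" using fin ne by (simp add: r_def card_gt_0_iff)
  define m where "m = (\<Sum>c\<in>\<sigma>. (1 / r) *\<^sub>R q c x)"
  have "m \<in> S"
    unfolding m_def S_def
  proof (rule convex_sum[OF fin convex_convex_hull])
    show "(\<Sum>i\<in>\<sigma>. 1 / r) = 1" using r by (simp add: r_def)
    show "q i x \<in> convex hull \<Union> (C ` \<sigma>)" if "i \<in> \<sigma>" for i
      using q(1)[OF that] that by (meson UN_I hull_inc)
  qed (use r in simp)
  have rm: "r *\<^sub>R m = (\<Sum>c\<in>\<sigma>. q c x)" using r by (simp add: m_def scaleR_sum_right)
  have zero: "(\<Sum>c\<in>\<sigma>. m - q c x) = 0"
    by (simp add: sum_subtractf rm[symmetric] r_def scaleR_conv_of_real sum_constant_scaleR)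
  have "\<Phi> m \<le> (\<Sum>c\<in>\<sigma>. (norm (m - q c x))\<^sup>2)"
    unfolding \<Phi>_def using q by (intro sum_mono power_mono) auto
  \<comment> \<open>Parallel axis identity: the cross term vanishes because \<open>m\<close> is the
    mean of the projections. Together with minimality it forces \<open>x = m\<close>.\<close>
  moreover have "\<Phi> x = (\<Sum>c\<in>\<sigma>. (norm (m - q c x))\<^sup>2) + r * (norm (x - m))\<^sup>2"
  proof -
    have "(norm (x - q c x))\<^sup>2 = (norm (m - q c x))\<^sup>2 + (norm (x - m))\<^sup>2 + 2 * ((x - m) \<bullet> (m - q c x))" for c
      by (simp add: power2_norm_eq_inner algebra_simps inner_commute)
    then have "\<Phi> x = (\<Sum>c\<in>\<sigma>. (norm (m - q c x))\<^sup>2) + r * (norm (x - m))\<^sup>2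
        + 2 * ((x - m) \<bullet> (\<Sum>c\<in>\<sigma>. m - q c x))"
      unfolding \<Phi>_def inner_sum_right by (simp add: sum.distrib r_def sum_distrib_left)
    then show ?thesis using zero by simp
  qed
  moreover have "\<Phi> x \<le> \<Phi> m" using x \<open>m \<in> S\<close> by blast
  ultimately have "r * (norm (x - m))\<^sup>2 \<le> 0" by linarith
  then have "x = m" using r by (simp add: mult_le_0_iff)
  show ?thesis
  proof (rule that[of "\<lambda>c. q c x - x" x])
    show "(\<Sum>c\<in>\<sigma>. q c x - x) = 0"
      using zero \<open>x = m\<close> by (metis (no_types, lifting) minus_diff_eq neg_equal_0_iff_equal sum.cong sum_negf)
    show "\<forall>c\<in>\<sigma>. \<forall>z\<in>C c. 0 \<le> (q c x - x) \<bullet> (z - x)"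
    proof (intro ballI)
      fix c z assume that: "c \<in> \<sigma>" "z \<in> C c"
      have "(x - q c x) \<bullet> (z - q c x) \<le> 0"
        unfolding q_def using C[OF that(1)] that(2) by (intro closest_point_dot) (auto simp: compact_imp_closed)
      moreover have "(q c x - x) \<bullet> (z - x) = (norm (q c x - x))\<^sup>2 - (x - q c x) \<bullet> (z - q c x)"
        by (simp add: power2_norm_eq_inner algebra_simps inner_commute)
      ultimately show "0 \<le> (q c x - x) \<bullet> (z - x)" by (smt (verit) zero_le_power2)
    qed
    show "\<exists>c\<in>\<sigma>. q c x - x \<noteq> 0"
    proof (rule ccontr)
      assume "\<not> ?thesis"
      then have "\<forall>c\<in>\<sigma>. x \<in> C c" using q(1) by (metis eq_iff_diff_eq_0)
      then show False using empty by blast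
    qed
  qed
qed

text \<open>Two sweeps. Forward: in column \<open>s\<close> all entries but that of
  \<open>b (Suc s)\<close> are bounded below, so the zero sum bounds this one above, and
  \<open>shared\<close> turns this into a lower bound in the next column, at the cost of a factor
  \<open>r + 1\<close>. The last column is then bounded on both sides. Backward:
  \<open>shared\<close> transfers the bound to the missing entry of the preceding column, at the
  cost of \<open>(r + 1)\<^sup>2\<close>. Hence the exponent \<open>3 * D\<close>.\<close>

lemma zero_sum_array_bound:
  fixes Z :: "nat \<Rightarrow> nat \<Rightarrow> real"
  assumes fin: "finite \<sigma>" and r: "r = real (card \<sigma>)" "r \<ge> 1" and \<delta>: "\<delta> \<ge> 0"
    and sum0: "\<And>s. s < D \<Longrightarrow> (\<Sum>c\<in>\<sigma>. Z c s) = 0"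
    and inner: "\<And>s c. \<lbrakk>s < D; c \<in> \<sigma>; c \<noteq> b s \<or> s = 0; c \<noteq> b (Suc s) \<or> Suc s = D\<rbrakk> \<Longrightarrow> Z c s \<ge> - \<delta>"
    and shared: "\<And>s. Suc s < D \<Longrightarrow> b (Suc s) \<in> \<sigma> \<and> Z (b (Suc s)) s + Z (b (Suc s)) (Suc s) \<ge> - \<delta>"
    and s: "s < D" and c: "c \<in> \<sigma>"
  shows "\<bar>Z c s\<bar> \<le> (r + 1) ^ (3 * D) * \<delta>"
proof -
  have up: "Z c0 s \<le> r * \<beta>"
    if "s < D" "c0 \<in> \<sigma>" "\<beta> \<ge> 0" "\<And>c. c \<in> \<sigma> \<Longrightarrow> c \<noteq> c0 \<Longrightarrow> Z c s \<ge> - \<beta>" for s c0 \<beta>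
  proof -
    have "(\<Sum>c\<in>\<sigma> - {c0}. - \<beta>) \<le> (\<Sum>c\<in>\<sigma> - {c0}. Z c s)" using that by (intro sum_mono) auto
    moreover have "(\<Sum>c\<in>\<sigma>. Z c s) = Z c0 s + (\<Sum>c\<in>\<sigma> - {c0}. Z c s)"
      using fin that by (simp add: sum.remove)
    moreover have "(\<Sum>c\<in>\<sigma> - {c0}. - \<beta>) = - (real (card (\<sigma> - {c0})) * \<beta>)" by simp
    moreover have "real (card (\<sigma> - {c0})) * \<beta> \<le> r * \<beta>"
      using that(3) fin r by (intro mult_right_mono) (auto simp: card_Diff1_le)
    ultimately show ?thesis using sum0[OF that(1)] by linarith
  qed
  have pw: "(r + 1) ^ a \<le> (r + 1) ^ b" if "a \<le> b" for a b using that r by (intro power_increasing) auto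
  have pwd: "(r + 1) ^ a * \<delta> \<le> (r + 1) ^ b * \<delta>" if "a \<le> b" for a b
    using pw[OF that] \<delta> by (rule mult_right_mono)
  have fwd: "Z c s \<ge> - ((r + 1) ^ s * \<delta>)"
    if "s < D" "c \<in> \<sigma>" "c \<noteq> b (Suc s) \<or> Suc s = D" for s c using that
  proof (induction s arbitrary: c)
    case 0
    then show ?case using inner[of 0 c] by simp
  next
    case (Suc s)
    have one: "\<delta> \<le> (r + 1) ^ a * \<delta>" for a using pwd[of 0 a] by simp
    show ?case
    proof (cases "c = b (Suc s)")
      case True
      have "Z c s \<le> r * ((r + 1) ^ s * \<delta>)"
      proof (rule up)
        show "- ((r + 1) ^ s * \<delta>) \<le> Z x s" if "x \<in> \<sigma>" "x \<noteq> c" for x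
          using Suc.IH[of x] that True Suc.prems by auto
      qed (use Suc.prems r \<delta> in auto)
      moreover have "Z c s + Z c (Suc s) \<ge> - \<delta>" using shared[of s] Suc.prems True by simp
      ultimately show ?thesis using one[of s] by (simp add: algebra_simps)
    next
      case False
      then have "Z c (Suc s) \<ge> - \<delta>" using inner[of "Suc s" c] Suc.prems by auto
      then show ?thesis using one[of "Suc s"] by linarith
    qed
  qed
  have abs: "\<bar>Z c s\<bar> \<le> r * \<beta>"
    if "s < D" "c \<in> \<sigma>" "\<beta> \<ge> 0" "\<And>c. c \<in> \<sigma> \<Longrightarrow> Z c s \<ge> - \<beta>" for s c \<beta>
  proof -
    have "\<beta> \<le> r * \<beta>" using r that(3) by (simp add: mult_le_cancel_right1)
    moreover have "Z c s \<le> r * \<beta>" using that by (intro up) auto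
    ultimately show ?thesis using that(4)[OF that(2)] by (simp add: abs_le_iff)
  qed
  have bwd: "\<bar>Z c s\<bar> \<le> (r + 1) ^ (D + 2 * t) * \<delta>" if "s + Suc t = D" "c \<in> \<sigma>" for s t c
    using that
  proof (induction t arbitrary: s c)
    case 0
    have "\<bar>Z c s\<bar> \<le> r * ((r + 1) ^ s * \<delta>)"
      using 0 fwd[of s] r \<delta> by (intro abs) auto
    also have "\<dots> \<le> (r + 1) * ((r + 1) ^ s * \<delta>)" using r \<delta> by (intro mult_right_mono) auto
    also have "\<dots> = (r + 1) ^ D * \<delta>" using 0(1) by auto
    finally show ?case by simp
  next
    case (Suc t)
    define \<gamma> where "\<gamma> = (r + 1) ^ (D + 2 * t) * \<delta>"
    have \<gamma>: "\<gamma> \<ge> \<delta>" "\<gamma> \<ge> 0" using pwd[of 0 "D + 2 * t"] \<delta> by (auto simp: \<gamma>_def)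
    have "\<bar>Z c s\<bar> \<le> r * (2 * \<gamma>)"
    proof (rule abs)
      fix x assume x: "x \<in> \<sigma>"
      show "- (2 * \<gamma>) \<le> Z x s"
      proof (cases "x = b (Suc s)")
        case True
        have "\<bar>Z x (Suc s)\<bar> \<le> \<gamma>" unfolding \<gamma>_def using Suc.IH[of "Suc s" x] Suc.prems x by simp
        moreover have "Z x s + Z x (Suc s) \<ge> - \<delta>" using shared[of s] Suc.prems True by simp
        ultimately show ?thesis using \<gamma> by linarith
      next
        case False
        then have "Z x s \<ge> - ((r + 1) ^ s * \<delta>)" using fwd[of s x] Suc.prems x by simp
        moreover have "(r + 1) ^ s * \<delta> \<le> \<gamma>" unfolding \<gamma>_def using Suc.prems by (intro pwd) simp
        ultimately show ?thesis using \<gamma> by linarith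
      qed
    qed (use Suc.prems \<gamma> in auto)
    also have "\<dots> \<le> (r + 1)\<^sup>2 * \<gamma>"
    proof -
      have "r * 2 \<le> (r + 1)\<^sup>2" by (simp add: power2_eq_square algebra_simps)
      from mult_right_mono[OF this \<gamma>(2)] show ?thesis by (simp add: mult.assoc)
    qed
    also have "\<dots> = (r + 1) ^ (D + 2 * Suc t) * \<delta>"
      by (simp add: \<gamma>_def power_add power2_eq_square)
    finally show ?case .
  qed
  obtain t where t: "s + Suc t = D" using s by (metis less_iff_Suc_add add_Suc_right)
  have "\<bar>Z c s\<bar> \<le> (r + 1) ^ (D + 2 * t) * \<delta>" using bwd[OF t c] .
  also have "\<dots> \<le> (r + 1) ^ (3 * D) * \<delta>" using t by (intro pwd) simp
  finally show ?thesis .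
qed

text \<open>The model is the moment curve with positive parameters growing by factors of at least
  \<open>K\<close>, where \<open>f j\<close> is the \<open>j\<close>-th power of the parameter.
  \<open>dominance\<close> is the growth of \<open>f (Suc j) / f j\<close> with denominators
  cleared. The first bound on \<open>K\<close> serves the way from a common point to a chain, the
  second the converse, where \<open>K\<close> has to beat the constant of
  \<open>zero_sum_array_bound\<close> for \<open>card \<sigma> \<le> N\<close>.\<close>

locale stretched =
  fixes p :: "nat \<Rightarrow> 'a::euclidean_space" and N D :: nat and f :: "nat \<Rightarrow> 'a \<Rightarrow> real" and K :: real
  assumes affine_f: "j < D \<Longrightarrow> \<exists>a b. \<forall>x. f j x = a + b \<bullet> x"
    and spanning: "\<exists>y. \<forall>x. a + b \<bullet> x = (\<Sum>j<D. y j * f j x)"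
    and pos: "i < N \<Longrightarrow> j < D \<Longrightarrow> f j (p i) > 0"
    and dominance: "i < i' \<Longrightarrow> i' < N \<Longrightarrow> Suc j < D \<Longrightarrow>
      K * f (Suc j) (p i) * f j (p i') \<le> f j (p i) * f (Suc j) (p i')"
    and K_gt_square: "K > (real N)\<^sup>2" and K_gt_power: "K > real D * (real N + 1) ^ (3 * D)"
    and D_pos: "D \<ge> 1"
begin

lemma K_gt_1: "K > 1"
proof -
  have "1 * 1 \<le> real D * (real N + 1) ^ (3 * D)"
    using D_pos by (intro mult_mono) auto
  then show ?thesis using K_gt_power by linarith
qed

lemma dominance_ratio:
  assumes "i < i'" "i' < N" "j < j'" "j' < D"
  shows "K * (f j (p i') / f j (p i)) \<le> f j' (p i') / f j' (p i)"
  using assms(3,4)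
proof (induction j')
  case (Suc l)
  have pos': "f j (p i) > 0" "f j (p i') > 0" if "j < D" for j using pos assms that by simp_all
  have step: "K * (f l (p i') / f l (p i)) \<le> f (Suc l) (p i') / f (Suc l) (p i)"
    using dominance[OF assms(1,2) Suc.prems(2)] pos'[of l] pos'[of "Suc l"] Suc.prems
    by (simp add: field_simps)
  show ?case
  proof (cases "l = j")
    case False
    then have "K * (f j (p i') / f j (p i)) \<le> f l (p i') / f l (p i)" using Suc by simp
    also have "\<dots> \<le> K * (f l (p i') / f l (p i))"
      using K_gt_1 pos'[of l] Suc.prems by (simp add: divide_right_mono)
    finally show ?thesis using step by linarith
  qed (use step in simp)
qed simp

lemma convex_hull_weights:
  assumes "z \<in> convex hull (p ` I)" "finite I"
  shows "\<exists>J w. J \<subseteq> I \<and> (\<forall>i\<in>J. 0 \<le> w i) \<and> (\<forall>j<D. f j z = (\<Sum>i\<in>J. w i * f j (p i)))"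
proof -
  \<comment> \<open>\<open>p\<close> is not assumed to be injective, so \<open>J\<close> picks one
    index for each point.\<close>
  obtain J where J: "J \<subseteq> I" "inj_on p J" "p ` I = p ` J" using subset_image_inj[of "p ` I" p I] by auto
  have fJ: "finite J" using J(1) assms(2) by (rule finite_subset)
  obtain u where u: "\<forall>x\<in>p ` J. 0 \<le> u x" "sum u (p ` J) = 1" "(\<Sum>x\<in>p ` J. u x *\<^sub>R x) = z"
    using assms(1) fJ unfolding J(3) by (auto simp: convex_hull_finite)
  have s: "(\<Sum>i\<in>J. u (p i)) = 1" using u(2) J(2) by (simp add: sum.reindex)
  have "f j z = (\<Sum>i\<in>J. u (p i) * f j (p i))" if j: "j < D" for j
  proof -
    obtain a b where ab: "\<And>x. f j x = a + b \<bullet> x" using affine_f[OF j] by blast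
    have "(\<Sum>i\<in>J. u (p i) * f j (p i)) = a * (\<Sum>i\<in>J. u (p i)) + b \<bullet> (\<Sum>i\<in>J. u (p i) *\<^sub>R p i)"
      unfolding ab by (simp add: inner_sum_right sum.distrib algebra_simps sum_distrib_left)
    also have "(\<Sum>i\<in>J. u (p i) *\<^sub>R p i) = z" using u(3) J(2) by (simp add: sum.reindex)
    finally show ?thesis using s by (simp add: ab)
  qed
  then show ?thesis using J(1) u(1) by (intro exI[of _ J] exI[of _ "u \<circ> p"]) simp
qed

lemma f_pos_convex_hull:
  assumes "z \<in> convex hull (p ` I)" "I \<subseteq> {..<N}" "j < D"
  shows "f j z > 0"
proof -
  obtain a b where ab: "\<And>x. f j x = a + b \<bullet> x" using affine_f[OF assms(3)] by blast
  have "{x. f j x > 0} = {x. b \<bullet> x > - a}" unfolding ab by auto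
  then have "convex {x. f j x > 0}" by (simp add: convex_halfspace_gt)
  moreover have "p ` I \<subseteq> {x. f j x > 0}" using assms pos by auto
  ultimately show ?thesis using assms(1) hull_minimal[of "p ` I" "{x. f j x > 0}" convex] by blast
qed

text \<open>In \<open>f j z = (\<Sum>i. w i * f j (p i))\<close> the index of the largest summand moves to the right as
  \<open>j\<close> grows, and this comparison is valid across the parts because \<open>z\<close> is the same.\<close>

lemma covering_chain_if_common_point:
  assumes W: "length W = N" and fin: "finite \<sigma>" and ne: "\<sigma> \<noteq> {}"
    and z: "\<And>c. c \<in> \<sigma> \<Longrightarrow> z \<in> convex hull (p ` {k. k < N \<and> W ! k = c})"
  shows "\<exists>e. covering_chain D \<sigma> W e"
proof -
  have "\<forall>c\<in>\<sigma>. \<exists>J w. J \<subseteq> {k. k < N \<and> W ! k = c} \<and> (\<forall>i\<in>J. 0 \<le> w i) \<and>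
    (\<forall>j<D. f j z = (\<Sum>i\<in>J. w i * f j (p i)))"
    using convex_hull_weights[OF z] by simp
  from bchoice[OF this] obtain J where "\<forall>c\<in>\<sigma>. \<exists>w. J c \<subseteq> {k. k < N \<and> W ! k = c} \<and>
    (\<forall>i\<in>J c. 0 \<le> w i) \<and> (\<forall>j<D. f j z = (\<Sum>i\<in>J c. w i * f j (p i)))"
    by (elim exE)
  from bchoice[OF this] obtain w where Jw: "\<forall>c\<in>\<sigma>. J c \<subseteq> {k. k < N \<and> W ! k = c} \<and>
    (\<forall>i\<in>J c. 0 \<le> w c i) \<and> (\<forall>j<D. f j z = (\<Sum>i\<in>J c. w c i * f j (p i)))"
    by (elim exE)
  have J: "J c \<subseteq> {k. k < N \<and> W ! k = c}" and w: "i \<in> J c \<Longrightarrow> 0 \<le> w c i"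
    and fz: "j < D \<Longrightarrow> f j z = (\<Sum>i\<in>J c. w c i * f j (p i))" if "c \<in> \<sigma>" for c i j
    using bspec[OF Jw that] by simp_all
  have finJ: "finite (J c)" if "c \<in> \<sigma>" for c using J[OF that] by (rule finite_subset) simp
  have cardJ: "card (J c) \<le> N" if "c \<in> \<sigma>" for c
    using card_mono[of "{..<N}" "J c"] J[OF that] by auto
  have fpos: "f j z > 0" if "j < D" for j
    using f_pos_convex_hull[OF z _ that] ne by blast
  have term_le: "w c i * f j (p i) \<le> f j z" if "c \<in> \<sigma>" "j < D" "i \<in> J c" for c j i
    unfolding fz[OF that(1,2)]
  proof (rule member_le_sum[OF that(3) _ finJ[OF that(1)]])
    fix x assume "x \<in> J c - {i}"
    then have x: "x \<in> J c" by blast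
    then have "x < N" using J[OF that(1)] by blast
    then have "0 \<le> w c x" "0 < f j (p x)" using w[OF that(1) x] pos[OF _ that(2)] by blast+
    then show "0 \<le> w c x * f j (p x)" by simp
  qed
  \<comment> \<open>The largest of at most \<open>N\<close> summands is at least the
    \<open>N\<close>-th part of the sum.\<close>
  have ex: "\<exists>i\<in>J c. f j z \<le> N * (w c i * f j (p i))" if "c \<in> \<sigma>" "j < D" for c j
  proof (rule ccontr)
    assume neg: "\<not> ?thesis"
    have lt: "N * (w c i * f j (p i)) < f j z" if "i \<in> J c" for i
      using neg that by (meson not_le)
    have "J c \<noteq> {}" using fz[OF that] fpos[OF that(2)] by auto
    then have "(\<Sum>i\<in>J c. N * (w c i * f j (p i))) < card (J c) * f j z"
      using lt finJ[OF that(1)] sum_strict_mono[of "J c" "\<lambda>i. N * (w c i * f j (p i))" "\<lambda>_. f j z"] by simp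
    also have "\<dots> \<le> N * f j z" using cardJ[OF that(1)] fpos[OF that(2)] by (intro mult_right_mono) auto
    finally show False using fz[OF that] by (simp add: sum_distrib_left)
  qed
  define m where "m = (\<lambda>c j. SOME i. i \<in> J c \<and> f j z \<le> N * (w c i * f j (p i)))"
  have m: "m c j \<in> J c \<and> f j z \<le> N * (w c (m c j) * f j (p (m c j)))" if "c \<in> \<sigma>" "j < D" for c j
    unfolding m_def by (rule someI_ex[OF ex[OF that, unfolded Bex_def]])
  have mono: "m c j \<le> m c' j'" if c: "c \<in> \<sigma>" "c' \<in> \<sigma>" and j: "j < j'" "j' < D" for c c' j j'
  proof (rule ccontr)
    define i i' where "i = m c' j'" and "i' = m c j"
    assume "\<not> ?thesis"
    then have ii: "i < i'" by (simp add: i_def i'_def)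
    have iJ: "i \<in> J c'" "i' \<in> J c" using m[of c' j'] m[of c j] c j by (auto simp: i_def i'_def)
    then have iN: "i < N" "i' < N" using J c by auto
    define a b where "a = w c' i" and "b = w c i'"
    have jD: "j < D" using j by simp
    have P: "f j (p i) > 0" "f j (p i') > 0" "f j' (p i) > 0" "f j' (p i') > 0"
      using pos iN j by auto
    have 1: "f j' z \<le> N * (a * f j' (p i))" and 2: "f j z \<le> N * (b * f j (p i'))"
      using m[of c' j'] m[of c j] c j by (auto simp: i_def i'_def a_def b_def)
    have 3: "a * f j (p i) \<le> f j z" and 4: "b * f j' (p i') \<le> f j' z"
      using term_le[OF c(2) jD iJ(1)] term_le[OF c(1) j(2) iJ(2)] by (auto simp: a_def b_def)
    have a: "a > 0"
    proof (rule ccontr)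
      assume "\<not> ?thesis"
      then have "a * f j' (p i) \<le> 0" using P by (simp add: mult_nonpos_nonneg)
      then have "N * (a * f j' (p i)) \<le> 0" by (simp add: mult_nonneg_nonpos)
      then show False using 1 fpos[OF j(2)] by linarith
    qed
    have b: "b > 0"
    proof (rule ccontr)
      assume "\<not> ?thesis"
      then have "b * f j (p i') \<le> 0" using P by (simp add: mult_nonpos_nonneg)
      then have "N * (b * f j (p i')) \<le> 0" by (simp add: mult_nonneg_nonpos)
      then show False using 2 fpos[OF jD] by linarith
    qed
    \<comment> \<open>Here \<open>i'\<close> is dominant at level \<open>j\<close> and
      \<open>i\<close> at the higher level \<open>j'\<close>, although \<open>i < i'\<close>. Level
      \<open>j'\<close> gives \<open>b * t' \<le> N * a\<close>, level \<open>j\<close> gives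
      \<open>a \<le> N * b * t\<close>, and with \<open>K * t \<le> t'\<close> this yields
      \<open>K \<le> (real N)\<^sup>2\<close>.\<close>
    define t t' where "t = f j (p i') / f j (p i)" and "t' = f j' (p i') / f j' (p i)"
    have t: "f j (p i') = t * f j (p i)" "f j' (p i') = t' * f j' (p i)" "t > 0" "t' > 0"
      using P by (auto simp: t_def t'_def)
    have Kt: "K * t \<le> t'" unfolding t_def t'_def using dominance_ratio[OF ii iN(2) j] .
    have "b * t' * f j' (p i) \<le> N * a * f j' (p i)" using 4 1 t(2) by (simp add: algebra_simps)
    then have A: "b * t' \<le> N * a" using P(3) by simp
    have "a * f j (p i) \<le> (N * b * t) * f j (p i)" using 3 2 t(1) by (simp add: algebra_simps)
    then have B: "a \<le> N * b * t" using P(1) by simp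
    have "K * (b * t) \<le> b * t'" using Kt b by (simp add: mult.left_commute)
    also have "\<dots> \<le> N * (N * b * t)" using A B mult_left_mono[OF B, of "real N"] by linarith
    finally have "K * (b * t) \<le> (real N)\<^sup>2 * (b * t)" by (simp add: power2_eq_square algebra_simps)
    then have "K \<le> (real N)\<^sup>2" using b t by simp
    then show False using K_gt_square by simp
  qed
  \<comment> \<open>By \<open>mono\<close> all dominant indices of level \<open>s - 1\<close> lie
    weakly before all those of level \<open>s\<close>, so their maximum can serve as the left end of
    interval \<open>s\<close>.\<close>
  define e where "e = (\<lambda>s. if s = 0 then 0 else Max ((\<lambda>c. m c (s - 1)) ` \<sigma>))"
  have "\<sigma> \<subseteq> letters_between W (e s) (e (Suc s))" if s: "s < D" for s
  proof
    fix c assume c: "c \<in> \<sigma>"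
    have "m c s \<in> J c" using m c s by blast
    then have "m c s < N" "W ! m c s = c" using J[OF c] by auto
    moreover have "m c s \<le> e (Suc s)" unfolding e_def using fin c by simp
    moreover have "e s \<le> m c s"
      unfolding e_def using fin ne mono[OF _ c, of _ "s - 1" s] s by auto
    ultimately show "c \<in> letters_between W (e s) (e (Suc s))"
      unfolding letters_between_def using W by (intro CollectI exI[of _ "m c s"]) simp
  qed
  then show ?thesis unfolding covering_chain_def by blast
qed

text \<open>The scales \<open>X\<close> make the functions \<open>f (s - 1) / X (s - 1)\<close> and \<open>f s / X s\<close> agree at the
  position \<open>E s\<close> shared by two consecutive segments. At every other position of the segment \<open>s\<close>
  the function \<open>f s / X s\<close> then dominates all others, so the nonnegative functionals of a
  certificate have almost nonnegative coefficients, while these coefficients sum to zero.\<close>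

lemma common_point_if_rainbow_chain:
  assumes W: "length W = N" and fin: "finite \<sigma>" and ne: "\<sigma> \<noteq> {}"
    and rc: "rainbow_chain D \<sigma> W E ix"
  shows "(\<Inter>c\<in>\<sigma>. convex hull (p ` {k. k < N \<and> W ! k = c})) \<noteq> {}"
proof
  assume empty: "(\<Inter>c\<in>\<sigma>. convex hull (p ` {k. k < N \<and> W ! k = c})) = {}"
  have E: "E s < N" "W ! E s \<in> \<sigma>" if "s \<le> D" for s
    using rc that W unfolding rainbow_chain_def by blast+
  have Es: "E s < E (Suc s)" "ix s (W ! E s) = E s" "ix s (W ! E (Suc s)) = E (Suc s)" if "s < D" for s
    using rc that unfolding rainbow_chain_def by blast+
  have ix: "W ! ix s c = c" "E s \<le> ix s c" "ix s c \<le> E (Suc s)" if "s < D" "c \<in> \<sigma>" for s c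
    using rc that unfolding rainbow_chain_def by blast+
  have ixN: "ix s c < N" if "s < D" "c \<in> \<sigma>" for s c
    using ix(3)[OF that] E(1)[of "Suc s"] that by simp
  have C: "compact (convex hull (p ` {k. k < N \<and> W ! k = c})) \<and>
      convex (convex hull (p ` {k. k < N \<and> W ! k = c})) \<and>
      convex hull (p ` {k. k < N \<and> W ! k = c}) \<noteq> {}" if c: "c \<in> \<sigma>" for c
  proof -
    have "ix 0 c \<in> {k. k < N \<and> W ! k = c}" using ix[OF _ c] ixN[OF _ c] D_pos by simp
    then show ?thesis by (auto intro!: finite_imp_compact_convex_hull)
  qed
  obtain v x0 where v: "(\<Sum>c\<in>\<sigma>. v c) = 0"
    "\<forall>c\<in>\<sigma>. \<forall>z\<in>convex hull (p ` {k. k < N \<and> W ! k = c}). 0 \<le> v c \<bullet> (z - x0)"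
    "\<exists>c\<in>\<sigma>. v c \<noteq> 0"
    by (rule disjoint_convex_sets_certificate[OF fin ne C empty])
  have "\<exists>y. \<forall>x. v c \<bullet> (x - x0) = (\<Sum>j<D. y j * f j x)" for c
    using spanning[of "- (v c \<bullet> x0)" "v c"] by (simp add: inner_diff_right)
  then obtain y where y: "v c \<bullet> (x - x0) = (\<Sum>j<D. y c j * f j x)" for c x by metis
  obtain c0 where c0: "c0 \<in> \<sigma>" using ne by blast
  text \<open>This choice of coefficients for \<open>c0\<close> makes them sum to zero without an appeal to the
    linear independence of the \<open>f j\<close>.\<close>
  define u where "u = (\<lambda>c j. if c = c0 then - (\<Sum>c\<in>\<sigma> - {c0}. y c j) else y c j)"
  have usum: "(\<Sum>c\<in>\<sigma>. u c j) = 0" for j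
    using fin c0 by (simp add: sum.remove[of \<sigma> c0] u_def)
  have u: "v c \<bullet> (x - x0) = (\<Sum>j<D. u c j * f j x)" for c x
  proof (cases "c = c0")
    case True
    have "v c0 = - (\<Sum>c\<in>\<sigma> - {c0}. v c)"
      using v(1) fin c0 by (simp add: sum.remove[of \<sigma> c0] eq_neg_iff_add_eq_0)
    then have "v c0 \<bullet> (x - x0) = - (\<Sum>c\<in>\<sigma> - {c0}. \<Sum>j<D. y c j * f j x)"
      by (simp only: inner_minus_left inner_sum_left y)
    also have "\<dots> = - (\<Sum>j<D. \<Sum>c\<in>\<sigma> - {c0}. y c j * f j x)" by (subst sum.swap) simp
    also have "\<dots> = (\<Sum>j<D. u c0 j * f j x)"
      by (simp add: u_def sum_distrib_right sum_negf)
    finally show ?thesis using True by simp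
  qed (simp add: u_def y)
  define X where "X = rec_nat 1 (\<lambda>s a. a * f (Suc s) (p (E (Suc s))) / f s (p (E (Suc s))))"
  have XS: "X (Suc s) = X s * f (Suc s) (p (E (Suc s))) / f s (p (E (Suc s)))" for s
    by (simp add: X_def)
  have X: "X s > 0" if "s < D" for s using that
  proof (induction s)
    case (Suc s)
    then show ?case using pos[of "E (Suc s)"] E(1)[of "Suc s"] by (simp add: XS)
  qed (simp add: X_def)
  define R where "R = (\<lambda>i j. f j (p i) / X j)"
  have R: "R i j > 0" if "i < N" "j < D" for i j using pos X that by (simp add: R_def)
  have fE: "f s (p (E (Suc s))) > 0" "f (Suc s) (p (E (Suc s))) > 0" if "Suc s < D" for s
    using pos[OF E(1)[of "Suc s"]] that by simp_all
  have RS: "R i (Suc s) = f s (p (E (Suc s))) * f (Suc s) (p i) / (f (Suc s) (p (E (Suc s))) * X s)"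
    for i s by (simp add: R_def XS mult_ac)
  have R': "K * R i s = K * f (Suc s) (p (E (Suc s))) * f s (p i) / (f (Suc s) (p (E (Suc s))) * X s)"
    if "Suc s < D" for i s
    using fE[OF that] by (simp add: R_def)
  have Req: "R (E (Suc s)) (Suc s) = R (E (Suc s)) s" if "Suc s < D" for s
    using fE[OF that] unfolding RS by (simp add: R_def)
  have Rup1: "K * R i s \<le> R i (Suc s)" if "E (Suc s) < i" "i < N" "Suc s < D" for i s
    unfolding RS R'[OF that(3)]
    using dominance[OF that] fE[OF that(3)] X[of s] that(3) by (intro divide_right_mono) simp_all
  have Rdn1: "K * R i (Suc s) \<le> R i s" if "i < E (Suc s)" "Suc s < D" for i s
  proof -
    have EN: "E (Suc s) < N" using E that by simp
    have "K * f (Suc s) (p i) * f s (p (E (Suc s))) / (f (Suc s) (p (E (Suc s))) * X s)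
        \<le> f s (p i) * f (Suc s) (p (E (Suc s))) / (f (Suc s) (p (E (Suc s))) * X s)"
      using dominance[OF that(1) EN that(2)] fE[OF that(2)] X[of s] that(2)
      by (intro divide_right_mono) simp_all
    also have "\<dots> = R i s" using fE[OF that(2)] by (simp add: R_def)
    finally show ?thesis unfolding RS by (simp add: mult_ac)
  qed
  have Emono: "E s \<le> E t" if "s \<le> t" "t \<le> D" for s t
    using that
  proof (induction t)
    case (Suc t)
    then show ?case using Es(1)[of t] by (cases "s = Suc t") simp_all
  qed simp
  have RK: "R i s \<le> K * R i s" if "i < N" "s < D" for i s
    using K_gt_1 R[OF that] by simp
  \<comment> \<open>Seen from a position beyond \<open>E s\<close>, \<open>R i\<close> grows by a
    factor of at least \<open>K\<close> per column up to column \<open>s\<close>; seen from a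
    position before \<open>E (Suc s)\<close>, it falls in the same way after column
    \<open>s\<close>.\<close>
  have Rup: "K * R i j \<le> R i s" if "j < s" "s < D" "E s < i" "i < N" for i j s using that
  proof (induction s)
    case (Suc s)
    have "K * R i s \<le> R i (Suc s)" using Suc.prems by (intro Rup1)
    moreover have "K * R i j \<le> R i s" if "j < s"
      using Suc.IH that Suc.prems Emono[of s "Suc s"] by simp
    moreover have "R i s \<le> K * R i s" using Suc.prems by (intro RK) auto
    ultimately show ?case using Suc.prems(1) by (cases "j = s") simp_all
  qed simp
  have Rdn: "K * R i j \<le> R i s" if "s < j" "j < D" "i < E (Suc s)" for i j s using that
  proof (induction j)
    case (Suc j)
    have iN: "i < N" using Suc.prems E(1)[of "Suc s"] by simp
    have "E (Suc s) \<le> E (Suc j)" using Suc.prems by (intro Emono) auto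
    then have "K * R i (Suc j) \<le> R i j" using Suc.prems by (intro Rdn1) auto
    moreover have "K * R i j \<le> R i s" if "s < j" using Suc.IH that Suc.prems by simp
    moreover have "R i j \<le> K * R i j" using Suc.prems iN by (intro RK) auto
    ultimately show ?case using Suc.prems(1) by (cases "s = j") simp_all
  qed simp
  define Z where "Z = (\<lambda>c j. u c j * X j)"
  define M where "M = Max ((\<lambda>(c, j). \<bar>Z c j\<bar>) ` (\<sigma> \<times> {..<D}))"
  have fM: "finite ((\<lambda>(c, j). \<bar>Z c j\<bar>) ` (\<sigma> \<times> {..<D}))" using fin by simp
  have M: "\<bar>Z c j\<bar> \<le> M" if "c \<in> \<sigma>" "j < D" for c j
    unfolding M_def using fM that by (intro Max_ge) auto
  have M0: "M \<ge> 0" using M[OF c0, of 0] D_pos by simp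
  have ZR: "0 \<le> (\<Sum>j<D. Z c j * R i j)" if "c \<in> \<sigma>" "i < N" "W ! i = c" for c i
  proof -
    have "p i \<in> convex hull (p ` {k. k < N \<and> W ! k = c})" using that by (intro hull_inc) blast
    then have "0 \<le> (\<Sum>j<D. u c j * f j (p i))" using bspec[OF bspec[OF v(2) that(1)]] u by simp
    also have "\<dots> = (\<Sum>j<D. Z c j * R i j)"
      by (intro sum.cong) (use X in \<open>auto simp: Z_def R_def less_imp_neq[symmetric]\<close>)
    finally show ?thesis .
  qed
  \<comment> \<open>At most \<open>D\<close> foreign terms occur, each with a coefficient of at most
    \<open>M\<close> and a size of at most \<open>R i s / K\<close>.\<close>
  define \<delta> where "\<delta> = D * M / K"
  have small: "\<bar>\<Sum>j\<in>A. Z c j * R i j\<bar> \<le> \<delta> * R i s"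
    if "c \<in> \<sigma>" "i < N" "s < D" "A \<subseteq> {..<D}" "\<And>j. j \<in> A \<Longrightarrow> K * R i j \<le> R i s" for A c i s
  proof -
    have "\<bar>\<Sum>j\<in>A. Z c j * R i j\<bar> \<le> (\<Sum>j\<in>A. \<bar>Z c j * R i j\<bar>)" by (rule sum_abs)
    also have "\<dots> \<le> (\<Sum>j\<in>A. M * (R i s / K))"
    proof (rule sum_mono)
      fix j assume j: "j \<in> A"
      then have jD: "j < D" using that(4) by blast
      have "R i j \<le> R i s / K"
        using that(5)[OF j] K_gt_1 by (simp add: pos_le_divide_eq mult.commute)
      then have "\<bar>Z c j\<bar> * R i j \<le> M * (R i s / K)"
        using M[OF that(1) jD] R[OF that(2) jD] M0 by (intro mult_mono) simp_all
      then show "\<bar>Z c j * R i j\<bar> \<le> M * (R i s / K)"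
        using R[OF that(2) jD] by (simp add: abs_mult)
    qed
    also have "\<dots> = card A * (M * (R i s / K))" by simp
    also have "\<dots> \<le> D * (M * (R i s / K))"
      using card_mono[OF _ that(4)] M0 R[OF that(2,3)] K_gt_1 by (intro mult_right_mono) simp_all
    finally show ?thesis by (simp add: \<delta>_def)
  qed
  have main: "\<bar>Z c s\<bar> \<le> (real (card \<sigma>) + 1) ^ (3 * D) * \<delta>" if "c \<in> \<sigma>" "s < D" for c s
  proof (rule zero_sum_array_bound[OF fin refl _ _ _ _ _ that(2,1), where b = "\<lambda>s. W ! E s"])
    show "1 \<le> real (card \<sigma>)" using fin ne by (simp add: Suc_le_eq card_gt_0_iff)
    show "0 \<le> \<delta>" using M0 K_gt_1 by (simp add: \<delta>_def)
    show "(\<Sum>c\<in>\<sigma>. Z c s) = 0" for s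
      using usum[of s] by (simp add: Z_def flip: sum_distrib_right)
  next
    fix s c assume s: "s < D" and c: "c \<in> \<sigma>" "c \<noteq> W ! E s \<or> s = 0" "c \<noteq> W ! E (Suc s) \<or> Suc s = D"
    define i where "i = ix s c"
    have i: "i < N" "W ! i = c" "E s \<le> i" "i \<le> E (Suc s)"
      unfolding i_def using ix[OF s c(1)] ixN[OF s c(1)] by auto
    \<comment> \<open>The position \<open>i\<close> lies strictly beyond \<open>E s\<close> unless
      no column precedes \<open>s\<close>, and strictly before \<open>E (Suc s)\<close> unless none
      follows. Hence column \<open>s\<close> beats all others at \<open>i\<close>.\<close>
    have Ki: "K * R i j \<le> R i s" if "j < D" "j \<noteq> s" for j
    proof (cases "j < s")
      case True
      then have "i \<noteq> E s" using c(2) i(2) by auto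
      then show ?thesis using Rup True s i by simp
    next
      case False
      then have "i \<noteq> E (Suc s)" using c(3) i(2) that by auto
      then show ?thesis using Rdn False that i by simp
    qed
    have "0 \<le> Z c s * R i s + (\<Sum>j\<in>{..<D} - {s}. Z c j * R i j)"
      using ZR[OF c(1) i(1,2)] s by (simp add: sum.remove[of _ s])
    moreover have "\<bar>\<Sum>j\<in>{..<D} - {s}. Z c j * R i j\<bar> \<le> \<delta> * R i s"
      using Ki i(1) s c(1) by (intro small) auto
    ultimately have "0 \<le> (Z c s + \<delta>) * R i s" by (simp add: algebra_simps)
    then show "- \<delta> \<le> Z c s" using R[OF i(1) s] by (simp add: zero_le_mult_iff)
  next
    fix s assume s: "Suc s < D"
    \<comment> \<open>At \<open>E (Suc s)\<close> the columns \<open>s\<close> and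
      \<open>Suc s\<close> have equal size by \<open>Req\<close>, so only the sum of their two
      coefficients can be bounded.\<close>
    define i c where "i = E (Suc s)" and "c = W ! i"
    have i: "i < N" "c \<in> \<sigma>" "E s < i" "i < E (Suc (Suc s))"
      using E[of "Suc s"] Es(1)[of s] Es(1)[of "Suc s"] s by (auto simp: i_def c_def)
    have Ki: "K * R i j \<le> R i s" if "j < D" "j \<noteq> s" "j \<noteq> Suc s" for j
    proof (cases "j < s")
      case True then show ?thesis using Rup s i by simp
    next
      case False
      then have "K * R i j \<le> R i (Suc s)" using Rdn that i by simp
      then show ?thesis using Req[OF s] by (simp add: i_def)
    qed
    have "{..<D} = insert s (insert (Suc s) ({..<D} - {s, Suc s}))" using s by auto
    then have "(\<Sum>j<D. Z c j * R i j) =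
        (\<Sum>j\<in>insert s (insert (Suc s) ({..<D} - {s, Suc s})). Z c j * R i j)" by simp
    also have "\<dots> = Z c s * R i s + Z c (Suc s) * R i (Suc s) + (\<Sum>j\<in>{..<D} - {s, Suc s}. Z c j * R i j)"
      by simp
    finally have "0 \<le> Z c s * R i s + Z c (Suc s) * R i s + (\<Sum>j\<in>{..<D} - {s, Suc s}. Z c j * R i j)"
      using ZR[OF i(2,1)] Req[OF s] by (simp add: c_def i_def)
    moreover have "\<bar>\<Sum>j\<in>{..<D} - {s, Suc s}. Z c j * R i j\<bar> \<le> \<delta> * R i s"
      using Ki i(1,2) s by (intro small) auto
    ultimately have "0 \<le> (Z c s + Z c (Suc s) + \<delta>) * R i s" by (simp add: algebra_simps)
    then have "0 \<le> Z c s + Z c (Suc s) + \<delta>" using R[OF i(1), of s] s by (simp add: zero_le_mult_iff)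
    then show "W ! E (Suc s) \<in> \<sigma> \<and> - \<delta> \<le> Z (W ! E (Suc s)) s + Z (W ! E (Suc s)) (Suc s)"
      using i(2) by (simp add: c_def i_def)
  qed
  have cN: "card \<sigma> \<le> N"
  proof -
    have "inj_on (ix 0) \<sigma>" using ix(1)[of 0] D_pos by (metis inj_onI less_eq_Suc_le One_nat_def)
    moreover have "ix 0 ` \<sigma> \<subseteq> {..<N}" using ixN[of 0] D_pos by auto
    ultimately show ?thesis using card_inj_on_le[of "ix 0" \<sigma> "{..<N}"] by simp
  qed
  \<comment> \<open>The maximum is one of the entries just bounded, and by the choice of
    \<open>K\<close> the bound is a proper fraction of \<open>M\<close>; so \<open>M\<close>
    vanishes.\<close>
  have "M \<in> (\<lambda>(c, j). \<bar>Z c j\<bar>) ` (\<sigma> \<times> {..<D})"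
    unfolding M_def using fM c0 D_pos by (intro Max_in) (auto simp: lessThan_empty_iff)
  then have "M \<le> (real (card \<sigma>) + 1) ^ (3 * D) * \<delta>" using main by auto
  also have "\<dots> \<le> (real N + 1) ^ (3 * D) * \<delta>"
    using cN M0 K_gt_1 by (intro mult_right_mono power_mono) (auto simp: \<delta>_def)
  also have "\<dots> = (D * (real N + 1) ^ (3 * D)) * M / K" by (simp add: \<delta>_def)
  finally have "K * M \<le> (D * (real N + 1) ^ (3 * D)) * M" using K_gt_1 by (simp add: field_simps)
  then have "M = 0" using K_gt_power M0 by (metis less_eq_real_def mult_le_cancel_right_pos not_less)
  have "v c = 0" if "c \<in> \<sigma>" for c
  proof -
    have "u c j = 0" if "j < D" for j
      using M[OF \<open>c \<in> \<sigma>\<close> that] \<open>M = 0\<close> X[OF that] by (simp add: Z_def)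
    then have "v c \<bullet> ((v c + x0) - x0) = 0" unfolding u by simp
    then show ?thesis by simp
  qed
  then show False using v(3) by blast
qed

lemma common_point_iff_colorful_subword:
  assumes "D = Suc d" "length W = N" "card \<sigma> \<ge> 2"
  shows "(\<Inter>c\<in>\<sigma>. convex hull (p ` {k. k < N \<and> W ! k = c})) \<noteq> {} \<longleftrightarrow>
    (\<exists>V. subseq V W \<and> colorful_word d \<sigma> V)"
proof -
  have fin: "finite \<sigma>" "\<sigma> \<noteq> {}" using assms(3) by (auto intro: card_ge_0_finite)
  show ?thesis
  proof
    assume "(\<Inter>c\<in>\<sigma>. convex hull (p ` {k. k < N \<and> W ! k = c})) \<noteq> {}"
    then obtain z where "\<And>c. c \<in> \<sigma> \<Longrightarrow> z \<in> convex hull (p ` {k. k < N \<and> W ! k = c})" by blast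
    from covering_chain_if_common_point[OF assms(2) fin this] obtain e where "covering_chain D \<sigma> W e"
      by blast
    from rainbow_chain_if_covering_chain[OF this assms(3) D_pos] obtain E ix
      where "rainbow_chain D \<sigma> W E ix" by blast
    then show "\<exists>V. subseq V W \<and> colorful_word d \<sigma> V"
      using colorful_if_rainbow_chain assms by blast
  next
    assume "\<exists>V. subseq V W \<and> colorful_word d \<sigma> V"
    then obtain e where "covering_chain D \<sigma> W e"
      using covering_chain_if_colorful assms by blast
    from rainbow_chain_if_covering_chain[OF this assms(3) D_pos] obtain E ix
      where "rainbow_chain D \<sigma> W E ix" by blast
    from common_point_if_rainbow_chain[OF assms(2) fin this]
    show "(\<Inter>c\<in>\<sigma>. convex hull (p ` {k. k < N \<and> W ! k = c})) \<noteq> {}" .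
  qed
qed

end

section \<open>Cross ratios of vector sequences\<close>

lemma sorted_map_strict_mono_on:
  assumes "strict_mono_on A s" "sorted_wrt (<) xs" "set xs \<subseteq> A"
  shows "sorted_wrt (<) (map s xs)"
  unfolding sorted_wrt_map
proof (rule sorted_wrt_mono_rel[where P = "(<)"])
  show "s x < s y" if "x \<in> set xs" "y \<in> set xs" "x < y" for x y
    using strict_mono_onD[OF assms(1), of x y] that assms(3) by auto
qed (fact assms(2))

text \<open>Ramsey's theorem for increasing tuples instead of sets. \<open>C\<close> is chosen
  before the colouring \<open>h\<close>; this uniformity is what finally gives one constant for all
  point sets.\<close>

lemma homogeneous_subsequence:
  fixes Q :: "'c set" and M r :: nat
  assumes "finite Q"
  shows "\<exists>C. \<forall>h :: nat list \<Rightarrow> 'c. (\<forall>xs. h xs \<in> Q) \<longrightarrow>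
    (\<exists>s c. strict_mono_on {..<M} s \<and> s ` {..<M} \<subseteq> {..<C} \<and>
      (\<forall>xs. sorted_wrt (<) xs \<and> set xs \<subseteq> {..<M} \<and> length xs = r \<longrightarrow> h (map s xs) = c))"
proof -
  obtain g where g: "bij_betw g Q {0..<card Q}" using ex_bij_betw_finite_nat[OF assms] by blast
  obtain C :: nat where C: "partn_lst {..<C} (replicate (card Q) M) r" using ramsey_full[of "replicate (card Q) M" r] by blast
  show ?thesis
  proof (intro exI[of _ C] allI impI)
    fix h :: "nat list \<Rightarrow> 'c" assume h: "\<forall>xs. h xs \<in> Q"
    define F where "F = (\<lambda>A. g (h (sorted_list_of_set A)))"
    have "F \<in> [{..<C}]\<^bsup>r\<^esup> \<rightarrow> {..<length (replicate (card Q) M)}"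
      using h bij_betwE[OF g] by (auto simp: F_def)
    with C obtain i where i: "i < card Q"
      and "monochromatic {..<C} (replicate (card Q) M ! i) r F i"
      unfolding partn_lst_def by auto
    then obtain A where A: "A \<in> nsets {..<C} M" "F ` (nsets A r) \<subseteq> {i}"
      unfolding monochromatic_def by auto
    have A': "A \<subseteq> {..<C}" "finite A" "card A = M" using A(1) by (auto simp: nsets_def)
    define s where "s = (\<lambda>k. sorted_list_of_set A ! k)"
    have len: "length (sorted_list_of_set A) = M" using A' by simp
    have s: "strict_mono_on {..<M} s"
      unfolding s_def strict_mono_on_def using len sorted_wrt_nth_less[OF strict_sorted_list_of_set[of A]]
      by auto
    have sA: "s k \<in> A" if "k < M" for k
      using that len A'(2) nth_mem[of k "sorted_list_of_set A"] by (simp add: s_def)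
    show "\<exists>s c. strict_mono_on {..<M} s \<and> s ` {..<M} \<subseteq> {..<C} \<and>
      (\<forall>xs. sorted_wrt (<) xs \<and> set xs \<subseteq> {..<M} \<and> length xs = r \<longrightarrow> h (map s xs) = c)"
    proof (intro exI[of _ s] exI[of _ "inv_into Q g i"] conjI allI impI s)
      show "s ` {..<M} \<subseteq> {..<C}" using sA A'(1) by auto
      fix xs assume xs: "sorted_wrt (<) xs \<and> set xs \<subseteq> {..<M} \<and> length xs = r"
      then have sorted: "sorted_wrt (<) (map s xs)" using sorted_map_strict_mono_on[OF s] by blast
      then have "sorted_list_of_set (set (map s xs)) = map s xs"
        using sorted_list_of_set.idem_if_sorted_distinct[of "map s xs"]
        by (simp add: strict_sorted_iff del: set_map list.set_map)
      moreover have "set (map s xs) \<in> nsets A r"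
        using sA xs sorted distinct_card[of "map s xs"] by (auto simp: nsets_def strict_sorted_iff)
      then have "F (set (map s xs)) = i" using A(2) by blast
      ultimately have "g (h (map s xs)) = i" by (simp add: F_def)
      then show "h (map s xs) = inv_into Q g i"
        using g h by (metis bij_betw_def inv_into_f_f)
    qed
  qed
qed

section \<open>Determinants as functions of a sequence of rows\<close>

definition row_index :: "'e::finite \<Rightarrow> nat" where
  "row_index = (SOME g. bij_betw g UNIV {..<CARD('e)})"

lemma bij_row_index: "bij_betw (row_index :: 'e::finite \<Rightarrow> nat) UNIV {..<CARD('e)}"
proof -
  have "\<exists>g :: 'e \<Rightarrow> nat. bij_betw g UNIV {..<CARD('e)}"
    using ex_bij_betw_finite_nat[of "UNIV :: 'e set"] by (simp add: atLeast0LessThan)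
  then show ?thesis unfolding row_index_def by (rule someI_ex)
qed

text \<open>Another choice of the bijection \<open>row_index\<close> would change
  \<open>rowdet\<close> by at most a global sign, which the factor \<epsilon> of
  \<open>oriented\<close> absorbs.\<close>

definition rowdet :: "(nat \<Rightarrow> real ^ 'e) \<Rightarrow> real" where
  "rowdet X = det (\<chi> i. X (row_index i))"

lemma rowdet_cong: "(\<And>k. k < CARD('e) \<Longrightarrow> X k = Y k) \<Longrightarrow> rowdet X = rowdet (Y :: nat \<Rightarrow> real ^ 'e)"
  unfolding rowdet_def using bij_betwE[OF bij_row_index]
  by (intro arg_cong[where f = det]) (auto simp: vec_eq_iff)

lemma linear_rowdet:
  fixes X :: "nat \<Rightarrow> real ^ 'e"
  assumes "k < CARD('e)"
  shows "linear (\<lambda>x. rowdet (X(k := x)))"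
proof -
  obtain i :: 'e where i: "row_index i = k"
    using bij_row_index assms by (metis bij_betw_iff_bijections lessThan_iff)
  have inj: "inj (row_index :: 'e \<Rightarrow> nat)" using bij_row_index bij_betw_def by blast
  have eq: "rowdet (X(k := x)) = det (\<chi> j. if j = i then x else X (row_index j))" for x
    unfolding rowdet_def using i inj
    by (intro arg_cong[where f = det]) (auto simp: vec_eq_iff inj_eq)
  show ?thesis
    unfolding eq
  proof (rule linearI)
    show "det (\<chi> j. if j = i then x + y else X (row_index j)) =
      det (\<chi> j. if j = i then x else X (row_index j)) + det (\<chi> j. if j = i then y else X (row_index j))"
      for x y by (rule det_row_add)
    show "det (\<chi> j. if j = i then c *\<^sub>R x else X (row_index j)) =
      c *\<^sub>R det (\<chi> j. if j = i then x else X (row_index j))" for c x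
      using det_row_mul[of i c "\<lambda>_. x"] unfolding scalar_mult_eq_scaleR by simp
  qed
qed

lemma rowdet_eq_0:
  fixes X :: "nat \<Rightarrow> real ^ 'e"
  assumes "k < CARD('e)" "l < CARD('e)" "k \<noteq> l" "X k = X l"
  shows "rowdet X = 0"
proof -
  obtain i j :: 'e where "row_index i = k" "row_index j = l"
    using bij_row_index assms by (metis bij_betw_iff_bijections lessThan_iff)
  then show ?thesis
    unfolding rowdet_def using assms
    by (intro det_identical_rows[of i j]) (auto simp: row_def vec_eq_iff)
qed

lemma rowdet_swap:
  fixes X :: "nat \<Rightarrow> real ^ 'e"
  assumes kl: "k < CARD('e)" "l < CARD('e)" "k \<noteq> l"
  shows "rowdet (X(k := a, l := b)) = - rowdet (X(k := b, l := a))"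
proof -
  define B where "B = (\<lambda>a b. rowdet (X(k := a, l := b)))"
  have B2: "B a (x + y) = B a x + B a y" for a x y
    unfolding B_def using linear_rowdet[OF kl(2), of "X(k := a)"] by (rule linear_add)
  have B1: "B (x + y) b = B x b + B y b" for b x y
    unfolding B_def fun_upd_twist[OF kl(3)]
    using linear_rowdet[OF kl(1), of "X(l := b)"] by (rule linear_add)
  have B0: "B a a = 0" for a unfolding B_def using kl by (intro rowdet_eq_0[of k l]) auto
  have "0 = B (a + b) (a + b)" using B0 by simp
  also have "\<dots> = B a b + B b a" by (subst B1, subst (1 2) B2) (simp add: B0)
  finally show ?thesis unfolding B_def by simp
qed

lemma span_rows_if_rowdet:
  fixes X :: "nat \<Rightarrow> real ^ 'e"
  assumes "rowdet X \<noteq> 0"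
  shows "span (X ` {..<CARD('e)}) = UNIV"
proof -
  define A :: "real ^ 'e ^ 'e" where "A = (\<chi> i. X (row_index i))"
  have "row_index ` (UNIV :: 'e set) = {..<CARD('e)}"
    using bij_row_index by (rule bij_betw_imp_surj_on)
  moreover have "rows A = X ` row_index ` (UNIV :: 'e set)"
    by (auto simp: rows_def row_def A_def image_def)
  ultimately have "rows A = X ` {..<CARD('e)}" by simp
  moreover have "invertible A" using assms by (simp add: A_def rowdet_def invertible_det_nz)
  then have "span (rows A) = UNIV"
    using matrix_left_invertible_span_rows[of A] by (auto simp: invertible_def)
  ultimately show ?thesis by simp
qed

text \<open>The difference of the two sides is linear in \<open>x\<close> and vanishes when
  \<open>x\<close> is one of the rows of \<open>X(k := u, l := w)\<close>, which span the space by
  \<open>nz\<close>.\<close>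

lemma pluecker:
  fixes X :: "nat \<Rightarrow> real ^ 'e"
  assumes kl: "k < CARD('e)" "l < CARD('e)" "k \<noteq> l"
    and nz: "rowdet (X(k := u, l := w)) \<noteq> 0"
  shows "rowdet (X(k := u, l := x)) * rowdet (X(k := y, l := w))
    + rowdet (X(k := u, l := w)) * rowdet (X(k := x, l := y))
    = rowdet (X(k := u, l := y)) * rowdet (X(k := x, l := w))"
proof -
  define B where "B = (\<lambda>a b. rowdet (X(k := a, l := b)))"
  have B2: "linear (B a)" for a
    unfolding B_def using linear_rowdet[OF kl(2), of "X(k := a)"] .
  have B1: "linear (\<lambda>a. B a b)" for b
    unfolding B_def fun_upd_twist[OF kl(3)] using linear_rowdet[OF kl(1), of "X(l := b)"] .
  have swap: "B a b = - B b a" for a b unfolding B_def using rowdet_swap[OF kl] .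
  have B0: "B a a = 0" for a using swap[of a a] by simp
  have BX: "B (X i) b = 0" "B a (X i) = 0" if "i < CARD('e)" "i \<noteq> k" "i \<noteq> l" for a b i
    unfolding B_def using kl that
    by (auto intro: rowdet_eq_0[of k i] rowdet_eq_0[of l i])
  define L where "L = (\<lambda>x. B u x * B y w + B u w * B x y - B u y * B x w)"
  have "linear L"
    by (intro linearI)
      (simp_all add: L_def linear_add[OF B1] linear_add[OF B2] linear_scale[OF B1] linear_scale[OF B2] algebra_simps)
  moreover have "L z = 0" if z: "z \<in> X(k := u, l := w) ` {..<CARD('e)}" for z
  proof -
    obtain i where i: "i < CARD('e)" "z = (X(k := u, l := w)) i" using z by blast
    then consider "z = u" | "z = w" | "i \<noteq> k" "i \<noteq> l" "z = X i" by (auto split: if_splits)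
    then show ?thesis
    proof cases
      case 1 then show ?thesis by (simp add: L_def B0)
    next
      case 2 then show ?thesis using swap[of w y] by (simp add: L_def B0)
    next
      case 3 then show ?thesis using BX[OF i(1)] by (simp add: L_def)
    qed
  qed
  ultimately have "L x = 0"
    using linear_eq_0_on_span[of L "X(k := u, l := w) ` {..<CARD('e)}" x] span_rows_if_rowdet[OF nz]
    by auto
  then show ?thesis unfolding L_def B_def by simp
qed

lemma triangular_system:
  fixes A :: "nat \<Rightarrow> nat \<Rightarrow> real"
  assumes "\<And>j k. j < k \<Longrightarrow> k < m \<Longrightarrow> A j k = 0" "\<And>k. k < m \<Longrightarrow> A k k \<noteq> 0"
  shows "\<exists>y. \<forall>k<m. (\<Sum>j<m. y j * A j k) = b k"
  using assms
proof (induction m arbitrary: b)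
  case (Suc m)
  define c where "c = b m / A m m"
  obtain y where y: "\<forall>k<m. (\<Sum>j<m. y j * A j k) = b k - c * A m k"
    using Suc.IH[of "\<lambda>k. b k - c * A m k"] Suc.prems by auto
  have "(\<Sum>j<Suc m. (y(m := c)) j * A j k) = b k" if "k < Suc m" for k
  proof -
    have *: "(\<Sum>j<Suc m. (y(m := c)) j * A j k) = (\<Sum>j<m. y j * A j k) + c * A m k" by simp
    show ?thesis
    proof (cases "k = m")
      case True
      have "(\<Sum>j<m. y j * A j m) = 0" using Suc.prems(1) by (intro sum.neutral) simp
      then show ?thesis using True Suc.prems(2)[of m] by (simp add: * c_def)
    next
      case False
      then show ?thesis using y that by (simp add: *)
    qed
  qed
  then show ?case by blast
qed simp

text \<open>Up to a constant, the 2 by 2 determinant of \<open>a\<close> and \<open>b\<close> in the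
  quotient by the rows of \<open>X\<close> other than \<open>l\<close> and
  \<open>Suc l\<close>.\<close>

definition bracket :: "(nat \<Rightarrow> real ^ 'e) \<Rightarrow> nat \<Rightarrow> real ^ 'e \<Rightarrow> real ^ 'e \<Rightarrow> real" where
  "bracket X l a b = rowdet (X(l := a, Suc l := b))"

lemma bracket_eq_rowdet:
  fixes X :: "nat \<Rightarrow> real ^ 'e"
  assumes "Y l = a" "Y (Suc l) = b"
    "\<And>k. k < CARD('e) \<Longrightarrow> k \<noteq> l \<Longrightarrow> k \<noteq> Suc l \<Longrightarrow> X k = Y k"
  shows "bracket X l a b = rowdet Y"
  unfolding bracket_def using assms by (intro rowdet_cong) auto

text \<open>In a projective line \<open>r(u,v,x,y) = [uv][xy] / ([ux][vy])\<close> is the cross ratio;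
  by the Pluecker relation \<open>r(u,v,x,y) > 1/2\<close> and \<open>r(v,x,y,w) > 1/2\<close> exclude each other.\<close>

lemma cross_ratio_dichotomy:
  fixes X :: "nat \<Rightarrow> real ^ 'e" and \<epsilon> :: real
  assumes l: "Suc l < CARD('e)"
  defines "B \<equiv> bracket X l"
  assumes pos: "\<epsilon> * B u x > 0" "\<epsilon> * B u y > 0" "\<epsilon> * B v x > 0" "\<epsilon> * B v y > 0"
    "\<epsilon> * B u w > 0" "\<epsilon> * B x y > 0" "\<epsilon> * B x w > 0" "\<epsilon> * B y w > 0"
  shows "2 * B u v * B x y \<le> B u x * B v y \<or> 2 * B v x * B y w \<le> B v y * B x w"
proof (rule ccontr)
  assume "\<not> ?thesis"
  then have neg: "B u x * B v y < 2 * B u v * B x y" "B v y * B x w < 2 * B v x * B y w" by auto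
  have \<epsilon>: "\<epsilon>\<^sup>2 > 0" using pos(1) by auto
  have pl: "B u v * B x y + B u y * B v x = B u x * B v y"
    "B u x * B y w + B u w * B x y = B u y * B x w"
    unfolding B_def bracket_def using pos(2,5) l unfolding B_def bracket_def
    by (intro pluecker; auto)+
  have sq: "0 < a * b" if "\<epsilon> * a > 0" "\<epsilon> * b > 0" for a b
  proof -
    have "0 < \<epsilon>\<^sup>2 * (a * b)" using mult_pos_pos[OF that] by (simp add: power2_eq_square mult_ac)
    then show ?thesis using \<epsilon> by (simp add: zero_less_mult_iff)
  qed
  \<comment> \<open>The first relation turns \<open>r(u,v,x,y) > 1/2\<close> into this inequality;
    the second one, with a positive term dropped, gives the next. Their product, divided by
    \<open>B u x * B u y\<close>, contradicts \<open>r(v,x,y,w) > 1/2\<close>. The unknown sign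
    \<epsilon> does no harm, as brackets enter in pairs.\<close>
  have "2 * (B u y * B v x) < B u x * B v y" using pl(1) neg(1) by linarith
  moreover have "B u x * B y w < B u y * B x w" using pl(2) sq[OF pos(5,6)] by linarith
  ultimately have "2 * (B u y * B v x) * (B u x * B y w) < B u x * B v y * (B u y * B x w)"
    by (rule mult_strict_mono) (use sq[OF pos(2,3)] sq[OF pos(1,8)] sq[OF pos(1,4)] in auto)
  then have "(B u x * B u y) * (2 * B v x * B y w) < (B u x * B u y) * (B v y * B x w)"
    by (simp add: mult_ac)
  then show False using neg(2) sq[OF pos(1,2)] by (simp add: mult_less_cancel_left)
qed

text \<open>The bracket at level \<open>l\<close> lives on the quotient by all vectors of the tuple \<open>xs\<close> except those
  at the four positions \<open>l, \<dots>, l + 3\<close>.\<close>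

definition small_cross_ratio :: "(nat \<Rightarrow> real ^ 'e) \<Rightarrow> nat \<Rightarrow> nat list \<Rightarrow> bool" where
  "small_cross_ratio v l xs \<longleftrightarrow>
     (let B = (\<lambda>i j. bracket (\<lambda>k. v (xs ! (if k < l then k else k + 2))) l (v (xs ! i)) (v (xs ! j)))
      in 2 * B l (l + 1) * B (l + 2) (l + 3) \<le> B l (l + 2) * B (l + 1) (l + 3))"

text \<open>The orientation pattern of points on the moment curve; only the sign of \<epsilon>
  matters.\<close>

definition oriented :: "nat \<Rightarrow> real \<Rightarrow> (nat \<Rightarrow> real ^ 'e) \<Rightarrow> bool" where
  "oriented M \<epsilon> v \<longleftrightarrow> (\<forall>xs. sorted_wrt (<) xs \<and> set xs \<subseteq> {..<M} \<and> length xs = CARD('e) \<longrightarrow>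
     \<epsilon> * rowdet (\<lambda>k. v (xs ! k)) > 0)"

text \<open>Five vectors at the indices \<open>l\<close> to \<open>l + 4\<close> are tested modulo
  the others: by the dichotomy the first four or the last four have a small cross ratio, and the
  fifth is dropped from the tuple. This excludes the case that Ramsey's theorem leaves open, a level
  without any small cross ratio.\<close>

lemma small_cross_ratio_exists:
  fixes v :: "nat \<Rightarrow> real ^ 'e"
  assumes l: "Suc l < CARD('e)" and or: "oriented M \<epsilon> v" and M: "CARD('e) + 3 \<le> M"
  shows "\<exists>xs. sorted_wrt (<) xs \<and> set xs \<subseteq> {..<M} \<and> length xs = CARD('e) + 2 \<and> small_cross_ratio v l xs"
proof -
  let ?D = "CARD('e)"
  define X where "X = (\<lambda>k. v (if k < l then k else k + 3))"
  define B where "B = (\<lambda>i j. bracket X l (v i) (v j))"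
  have pos: "\<epsilon> * B i j > 0" if "l \<le> i" "i < j" "j \<le> l + 4" for i j
  proof -
    define xs where "xs = [0..<l] @ [i, j] @ [l + 5..<?D + 3]"
    have "B i j = rowdet (\<lambda>k. v (xs ! k))"
      unfolding B_def
      by (rule bracket_eq_rowdet) (auto simp: X_def xs_def nth_append nth_Cons' intro!: arg_cong[where f = v])
    moreover have "sorted_wrt (<) xs" "set xs \<subseteq> {..<M}" "length xs = ?D"
      using that l M by (auto simp: xs_def sorted_wrt_append)
    ultimately show ?thesis using or by (simp add: oriented_def)
  qed
  have "2 * B l (l + 1) * B (l + 2) (l + 3) \<le> B l (l + 2) * B (l + 1) (l + 3) \<or>
      2 * B (l + 1) (l + 2) * B (l + 3) (l + 4) \<le> B (l + 1) (l + 3) * B (l + 2) (l + 4)"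
    unfolding B_def
    by (rule cross_ratio_dichotomy[where \<epsilon> = \<epsilon> and w = "v (l + 4)"])
      (use l pos in \<open>auto simp: B_def\<close>)
  then show ?thesis
  proof
    assume le: "2 * B l (l + 1) * B (l + 2) (l + 3) \<le> B l (l + 2) * B (l + 1) (l + 3)"
    define xs where "xs = [0..<l + 4] @ [l + 5..<?D + 3]"
    have nth: "xs ! k = (if k < l + 4 then k else k + 1)" if "k < ?D + 2" for k
      using that l by (auto simp: xs_def nth_append simp del: upt_Suc)
    have "bracket (\<lambda>k. v (xs ! (if k < l then k else k + 2))) l (v (xs ! i)) (v (xs ! j)) = B i j"
      if "i < l + 4" "j < l + 4" for i j
      unfolding B_def bracket_def using nth that l
      by (intro rowdet_cong) (auto simp: X_def numeral_3_eq_3)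
    then have "small_cross_ratio v l xs" using le by (simp add: small_cross_ratio_def)
    moreover have "sorted_wrt (<) xs" "set xs \<subseteq> {..<M}" "length xs = ?D + 2"
      using l M by (auto simp: xs_def sorted_wrt_append simp del: upt_Suc)
    ultimately show ?thesis by blast
  next
    assume le: "2 * B (l + 1) (l + 2) * B (l + 3) (l + 4) \<le> B (l + 1) (l + 3) * B (l + 2) (l + 4)"
    define xs where "xs = [0..<l] @ [l + 1..<?D + 3]"
    have nth: "xs ! k = (if k < l then k else k + 1)" if "k < ?D + 2" for k
      using that l by (auto simp: xs_def nth_append simp del: upt_Suc)
    have "bracket (\<lambda>k. v (xs ! (if k < l then k else k + 2))) l (v (xs ! i)) (v (xs ! j)) = B (i + 1) (j + 1)"
      if "l \<le> i" "l \<le> j" "i < l + 4" "j < l + 4" for i j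
      unfolding B_def bracket_def using nth that l
      by (intro rowdet_cong) (auto simp: X_def numeral_3_eq_3)
    then have "small_cross_ratio v l xs" using le by (simp add: small_cross_ratio_def eval_nat_numeral)
    moreover have "sorted_wrt (<) xs" "set xs \<subseteq> {..<M}" "length xs = ?D + 2"
      using l M by (auto simp: xs_def sorted_wrt_append simp del: upt_Suc)
    ultimately show ?thesis by blast
  qed
qed

lemma geometric_growth:
  fixes \<rho> :: "nat \<Rightarrow> real"
  assumes "\<And>z. a \<le> z \<Longrightarrow> Suc z < b \<Longrightarrow> 2 * \<rho> z \<le> \<rho> (Suc z)" "a \<le> z" "z + m < b"
  shows "2 ^ m * \<rho> z \<le> \<rho> (z + m)"
  using assms(3)
proof (induction m)
  case (Suc m)
  then have "2 * (2 ^ m * \<rho> z) \<le> 2 * \<rho> (z + m)" by simp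
  also have "\<dots> \<le> \<rho> (z + Suc m)" using assms(1)[of "z + m"] assms(2) Suc.prems by simp
  finally show ?case by simp
qed simp

text \<open>The functionals are \<open>z \<mapsto> det (v 0, \<dots>, v (j - 1), z, w (j + 1), \<dots>)\<close> with the vectors \<open>w\<close> taken
  from the far end of the sequence. The quotient of two consecutive ones is a bracket quotient on
  a projective line, and passing from one middle vector to the next at least doubles it.\<close>

lemma dominant_functionals:
  fixes v :: "nat \<Rightarrow> real ^ 'e"
  assumes or: "oriented M \<epsilon> v" and M: "M = 2 * CARD('e) + N * q" and q: "q > 0"
    and small: "\<forall>l xs. Suc l < CARD('e) \<and> sorted_wrt (<) xs \<and> set xs \<subseteq> {..<M} \<and>
      length xs = CARD('e) + 2 \<longrightarrow> small_cross_ratio v l xs"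
  defines "x \<equiv> \<lambda>i. CARD('e) + i * q"
  shows "\<exists>f :: nat \<Rightarrow> real ^ 'e \<Rightarrow> real. (\<forall>j<CARD('e). linear (f j)) \<and>
    (\<forall>\<phi>. linear \<phi> \<longrightarrow> (\<exists>y. \<forall>z. \<phi> z = (\<Sum>j<CARD('e). y j * f j z))) \<and>
    (\<forall>i<N. \<forall>j<CARD('e). f j (v (x i)) > 0) \<and>
    (\<forall>i i' j. i < i' \<and> i' < N \<and> Suc j < CARD('e) \<longrightarrow>
      2 ^ q * f (Suc j) (v (x i)) * f j (v (x i')) \<le> f j (v (x i)) * f (Suc j) (v (x i')))"
proof -
  let ?D = "CARD('e)"
  \<comment> \<open>The indices split into \<open>CARD('e)\<close> front ones, \<open>N * q\<close>
    middle ones and \<open>CARD('e)\<close> far ones, which \<open>w\<close> enumerates.\<close>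
  define w where "w = (\<lambda>k. ?D + N * q + k)"
  define X where "X = (\<lambda>j k. v (if k < j then k else w k))"
  define f where "f = (\<lambda>j z. \<epsilon> * rowdet ((X j)(j := z)))"
  have lin: "linear (f j)" if "j < ?D" for j
    unfolding f_def using linear_rowdet[OF that] linear_compose_scale_right[of "\<lambda>x. rowdet ((X j)(j := x))" \<epsilon>]
    by simp
  have row: "f j (v z) > 0" if "j < ?D" "?D \<le> z" "z < w (Suc j)" for j z
  proof -
    define xs where "xs = [0..<j] @ [z] @ [w (Suc j)..<M]"
    have "rowdet ((X j)(j := v z)) = rowdet (\<lambda>k. v (xs ! k))"
      using that by (intro rowdet_cong)
        (auto simp: xs_def X_def nth_append nth_Cons' w_def M simp del: upt_Suc intro!: arg_cong[where f = v])
    moreover have "sorted_wrt (<) xs" "set xs \<subseteq> {..<M}" "length xs = ?D"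
      using that by (auto simp: xs_def sorted_wrt_append w_def M simp del: upt_Suc)
    ultimately show ?thesis using or by (simp add: oriented_def f_def)
  qed
  \<comment> \<open>A row is repeated. On the basis of the vectors \<open>v (w k)\<close> the
    functionals are therefore triangular, with nonzero diagonal by \<open>row\<close>; this gives
    the spanning property.\<close>
  have fw0: "f j (v (w k)) = 0" if "j < k" "k < ?D" for j k
    unfolding f_def using that by (simp, intro disjI2 rowdet_eq_0[of j k]) (auto simp: X_def)
  have span: "span (v ` w ` {..<?D}) = UNIV"
  proof -
    define xs where "xs = [w 0..<M]"
    have "sorted_wrt (<) xs" "set xs \<subseteq> {..<M}" "length xs = ?D"
      by (auto simp: xs_def w_def M simp del: upt_Suc)
    then have "rowdet (\<lambda>k. v (xs ! k)) \<noteq> 0" using or by (force simp: oriented_def)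
    moreover have "rowdet (\<lambda>k. v (xs ! k)) = rowdet (\<lambda>k. v (w k))"
      by (intro rowdet_cong) (auto simp: xs_def w_def M simp del: upt_Suc)
    ultimately show ?thesis using span_rows_if_rowdet[of "\<lambda>k. v (w k)"] by (simp add: image_image)
  qed
  have spanning: "\<exists>y. \<forall>z. \<phi> z = (\<Sum>j<?D. y j * f j z)" if "linear \<phi>" for \<phi> :: "real ^ 'e \<Rightarrow> real"
  proof -
    have "f k (v (w k)) \<noteq> 0" if "k < ?D" for k
      using row[OF that, of "w k"] by (simp add: w_def)
    from triangular_system[of ?D "\<lambda>j k. f j (v (w k))" "\<lambda>k. \<phi> (v (w k))", OF fw0 this]
    obtain y where y: "\<forall>k<?D. (\<Sum>j<?D. y j * f j (v (w k))) = \<phi> (v (w k))" by blast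
    have "linear (\<lambda>z. y j * f j z)" if "j < ?D" for j
      using linear_compose_scale_right[OF lin[OF that], of "y j"] by simp
    then have "linear (\<lambda>z. \<Sum>j<?D. y j * f j z)" by (intro linear_compose_sum) simp
    moreover have "\<phi> a = (\<Sum>j<?D. y j * f j a)" if "a \<in> v ` w ` {..<?D}" for a using that y by auto
    ultimately have "\<phi> z = (\<Sum>j<?D. y j * f j z)" for z
      using linear_eq_on_span[OF that, of _ "v ` w ` {..<?D}" z] span by simp
    then show ?thesis by blast
  qed
  \<comment> \<open>Up to \<epsilon>, both functionals are brackets over the same remaining rows:
    \<open>f (Suc j)\<close> has \<open>v j\<close> in the first slot, \<open>f j\<close> has
    \<open>v (w (Suc j))\<close> in the second. A small cross ratio of \<open>v j\<close>,
    \<open>v z\<close>, \<open>v (Suc z)\<close>, \<open>v (w (Suc j))\<close> is the claim with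
    denominators cleared.\<close>
  have double: "2 * (f (Suc j) (v z) / f j (v z)) \<le> f (Suc j) (v (Suc z)) / f j (v (Suc z))"
    if j: "Suc j < ?D" and z: "?D \<le> z" "Suc z < ?D + N * q" for j z
  proof -
    define xs where "xs = [0..<Suc j] @ [z, Suc z] @ [w (Suc j)..<M]"
    have xs: "sorted_wrt (<) xs" "set xs \<subseteq> {..<M}" "length xs = ?D + 2"
      using j z by (auto simp: xs_def sorted_wrt_append w_def M simp del: upt_Suc)
    have nth: "k \<le> j \<Longrightarrow> xs ! k = k" "xs ! Suc j = z" "xs ! Suc (Suc j) = Suc z"
      "Suc j \<le> k \<Longrightarrow> k < ?D \<Longrightarrow> xs ! Suc (Suc k) = w k" for k
      using j by (auto simp: xs_def nth_append nth_Cons' w_def M simp del: upt_Suc)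
    define Y where "Y = (\<lambda>k. v (xs ! (if k < j then k else k + 2)))"
    have f1: "f (Suc j) a = \<epsilon> * bracket Y j (v j) a" for a
      unfolding f_def bracket_def using j
      by (intro arg_cong[where f = "(*) \<epsilon>"] rowdet_cong) (auto simp: Y_def X_def nth less_Suc_eq)
    have f0: "f j a = \<epsilon> * bracket Y j a (v (w (Suc j)))" for a
      unfolding f_def bracket_def using j
      by (intro arg_cong[where f = "(*) \<epsilon>"] rowdet_cong) (auto simp: Y_def X_def nth less_Suc_eq)
    have "2 * bracket Y j (v j) (v z) * bracket Y j (v (Suc z)) (v (w (Suc j)))
        \<le> bracket Y j (v j) (v (Suc z)) * bracket Y j (v z) (v (w (Suc j)))"
      using small[rule_format, OF conjI[OF j conjI[OF xs(1) conjI[OF xs(2,3)]]]] j nth(1)[of j] nth(2,3) nth(4)[of "Suc j"]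
      by (simp add: small_cross_ratio_def Y_def[symmetric] numeral_2_eq_2 numeral_3_eq_3)
    then have "\<epsilon>\<^sup>2 * (2 * bracket Y j (v j) (v z) * bracket Y j (v (Suc z)) (v (w (Suc j))))
        \<le> \<epsilon>\<^sup>2 * (bracket Y j (v j) (v (Suc z)) * bracket Y j (v z) (v (w (Suc j))))"
      by (rule mult_left_mono) simp
    then have "2 * f (Suc j) (v z) * f j (v (Suc z)) \<le> f (Suc j) (v (Suc z)) * f j (v z)"
      unfolding f0 f1 by (simp add: power2_eq_square mult_ac)
    moreover have "f j (v z) > 0" "f j (v (Suc z)) > 0" using row j z by (auto simp: w_def)
    ultimately show ?thesis by (simp add: field_simps)
  qed
  have x: "?D \<le> x i" "x i < ?D + N * q" "x i < w j" if "i < N" for i j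
    using that q by (auto simp: x_def w_def intro: trans_less_add1)
  have dom: "2 ^ q * f (Suc j) (v (x i)) * f j (v (x i')) \<le> f j (v (x i)) * f (Suc j) (v (x i'))"
    if "i < i'" "i' < N" "Suc j < ?D" for i i' j
  proof -
    have pos: "f j (v (x i)) > 0" "f j (v (x i')) > 0" "f (Suc j) (v (x i)) > 0"
      using row[OF _ x(1,3)] that by simp_all
    \<comment> \<open>The selected vectors lie \<open>q\<close> apart, so at least \<open>q\<close>
      doublings happen between two of them.\<close>
    define m where "m = (i' - i) * q"
    have "Suc i * q \<le> i' * q" using that(1) by (intro mult_le_mono1) simp
    then have m: "x i' = x i + m" "q \<le> m"
      using that(1) by (auto simp: x_def m_def diff_mult_distrib)
    have "2 ^ m * (f (Suc j) (v (x i)) / f j (v (x i))) \<le> f (Suc j) (v (x i + m)) / f j (v (x i + m))"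
      using x[of i] x[of i'] that m
      by (intro geometric_growth[where a = ?D and b = "?D + N * q"] double) auto
    moreover have "(2::real) ^ q \<le> 2 ^ m" using m by (intro power_increasing) auto
    then have "2 ^ q * (f (Suc j) (v (x i)) / f j (v (x i))) \<le> 2 ^ m * (f (Suc j) (v (x i)) / f j (v (x i)))"
      using pos by (intro mult_right_mono) auto
    ultimately have "2 ^ q * (f (Suc j) (v (x i)) / f j (v (x i))) \<le> f (Suc j) (v (x i')) / f j (v (x i'))"
      unfolding m(1) by linarith
    then show ?thesis using pos by (simp add: field_simps)
  qed
  have "f j (v (x i)) > 0" if "i < N" "j < ?D" for i j
    using row[OF that(2) x(1,3)[OF that(1)]] .
  then show ?thesis using lin spanning dom by (intro exI[of _ f] conjI) blast+
qed

section \<open>Ramsey passage to dominated subsequences\<close>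

lemma oriented_comp:
  fixes v :: "nat \<Rightarrow> real ^ 'e"
  assumes "oriented C \<epsilon> v" "strict_mono_on {..<M} s" "s ` {..<M} \<subseteq> {..<C}"
  shows "oriented M \<epsilon> (v \<circ> s)"
  unfolding oriented_def
proof (intro allI impI)
  fix xs assume xs: "sorted_wrt (<) xs \<and> set xs \<subseteq> {..<M} \<and> length xs = CARD('e)"
  then have "sorted_wrt (<) (map s xs) \<and> set (map s xs) \<subseteq> {..<C} \<and> length (map s xs) = CARD('e)"
    using sorted_map_strict_mono_on[OF assms(2)] assms(3) by auto
  then have "0 < \<epsilon> * rowdet (\<lambda>k. v (map s xs ! k))" using assms(1) unfolding oriented_def by blast
  moreover have "rowdet (\<lambda>k. v (map s xs ! k)) = rowdet (\<lambda>k. (v \<circ> s) (xs ! k))"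
    using xs by (intro rowdet_cong) simp
  ultimately show "0 < \<epsilon> * rowdet (\<lambda>k. (v \<circ> s) (xs ! k))" by simp
qed

lemma small_cross_ratio_map:
  fixes v :: "nat \<Rightarrow> real ^ 'e"
  assumes "length xs = CARD('e) + 2" "Suc l < CARD('e)"
  shows "small_cross_ratio v l (map s xs) = small_cross_ratio (v \<circ> s) l xs"
proof -
  have "bracket (\<lambda>k. v (map s xs ! (if k < l then k else k + 2))) l (v (map s xs ! i)) (v (map s xs ! j))
      = bracket (\<lambda>k. (v \<circ> s) (xs ! (if k < l then k else k + 2))) l ((v \<circ> s) (xs ! i)) ((v \<circ> s) (xs ! j))"
    if "i \<le> l + 3" "j \<le> l + 3" for i j
    unfolding bracket_def using that assms by (intro rowdet_cong) auto
  then show ?thesis by (simp add: small_cross_ratio_def Let_def)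
qed

lemma oriented_subsequence:
  "\<exists>C. \<forall>v :: nat \<Rightarrow> real ^ 'e.
    (\<forall>xs. sorted_wrt (<) xs \<and> set xs \<subseteq> {..<C} \<and> length xs = CARD('e) \<longrightarrow> rowdet (\<lambda>k. v (xs ! k)) \<noteq> 0) \<longrightarrow>
    (\<exists>s \<epsilon>. strict_mono_on {..<M} s \<and> s ` {..<M} \<subseteq> {..<C} \<and> oriented M \<epsilon> (v \<circ> s))"
proof -
  have "finite (UNIV :: bool set)" by simp
  from homogeneous_subsequence[OF this, of M "CARD('e)"] obtain C where
    C: "\<And>h :: nat list \<Rightarrow> bool. \<exists>s c. strict_mono_on {..<M} s \<and> s ` {..<M} \<subseteq> {..<C} \<and>
      (\<forall>xs. sorted_wrt (<) xs \<and> set xs \<subseteq> {..<M} \<and> length xs = CARD('e) \<longrightarrow> h (map s xs) = c)"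
    by auto
  show ?thesis
  proof (intro exI[of _ C] allI impI)
    fix v :: "nat \<Rightarrow> real ^ 'e"
    assume nz: "\<forall>xs. sorted_wrt (<) xs \<and> set xs \<subseteq> {..<C} \<and> length xs = CARD('e) \<longrightarrow>
      rowdet (\<lambda>k. v (xs ! k)) \<noteq> 0"
    from C[of "\<lambda>xs. rowdet (\<lambda>k. v (xs ! k)) > 0"] obtain s c where
      s: "strict_mono_on {..<M} s" "s ` {..<M} \<subseteq> {..<C}" and
      c: "\<And>xs. sorted_wrt (<) xs \<Longrightarrow> set xs \<subseteq> {..<M} \<Longrightarrow> length xs = CARD('e) \<Longrightarrow>
        (rowdet (\<lambda>k. v (map s xs ! k)) > 0) = c" by auto
    have "oriented M (if c then 1 else - 1) (v \<circ> s)"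
      unfolding oriented_def
    proof (intro allI impI)
      fix xs assume xs: "sorted_wrt (<) xs \<and> set xs \<subseteq> {..<M} \<and> length xs = CARD('e)"
      then have "sorted_wrt (<) (map s xs) \<and> set (map s xs) \<subseteq> {..<C} \<and> length (map s xs) = CARD('e)"
        using sorted_map_strict_mono_on[OF s(1)] s(2) by auto
      then have "rowdet (\<lambda>k. v (map s xs ! k)) \<noteq> 0" using nz by blast
      moreover have "rowdet (\<lambda>k. v (map s xs ! k)) = rowdet (\<lambda>k. (v \<circ> s) (xs ! k))"
        using xs by (intro rowdet_cong) simp
      ultimately show "0 < (if c then 1 else - 1) * rowdet (\<lambda>k. (v \<circ> s) (xs ! k))"
        using c[of xs] xs by auto
    qed
    then show "\<exists>s \<epsilon>. strict_mono_on {..<M} s \<and> s ` {..<M} \<subseteq> {..<C} \<and> oriented M \<epsilon> (v \<circ> s)"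
      using s by blast
  qed
qed

text \<open>Two Ramsey passes: the first fixes the orientation, the second the set of levels with a
  small cross ratio. By \<open>small_cross_ratio_exists\<close> no level can be missing from that
  common set.\<close>

lemma dominated_subsequence:
  fixes N q :: nat
  assumes q: "q > 0"
  shows "\<exists>C. \<forall>v :: nat \<Rightarrow> real ^ 'e.
    (\<forall>xs. sorted_wrt (<) xs \<and> set xs \<subseteq> {..<C} \<and> length xs = CARD('e) \<longrightarrow> rowdet (\<lambda>k. v (xs ! k)) \<noteq> 0) \<longrightarrow>
    (\<exists>s (f :: nat \<Rightarrow> real ^ 'e \<Rightarrow> real). inj_on s {..<N} \<and> s ` {..<N} \<subseteq> {..<C} \<and>
      (\<forall>j<CARD('e). linear (f j)) \<and>
      (\<forall>\<phi>. linear \<phi> \<longrightarrow> (\<exists>y. \<forall>z. \<phi> z = (\<Sum>j<CARD('e). y j * f j z))) \<and>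
      (\<forall>i<N. \<forall>j<CARD('e). f j (v (s i)) > 0) \<and>
      (\<forall>i i' j. i < i' \<and> i' < N \<and> Suc j < CARD('e) \<longrightarrow>
        2 ^ q * f (Suc j) (v (s i)) * f j (v (s i')) \<le> f j (v (s i)) * f (Suc j) (v (s i'))))"
proof -
  let ?D = "CARD('e)"
  \<comment> \<open>The summand 3 leaves room for the \<open>CARD('e) + 3\<close> indices of
    \<open>small_cross_ratio_exists\<close> even if \<open>N = 0\<close>.\<close>
  define M where "M = 2 * ?D + (N + 3) * q"
  have M: "?D + 3 \<le> M" using q by (simp add: M_def add_mult_distrib)
  have "finite (Pow {..<?D})" by simp
  from homogeneous_subsequence[OF this, of M "?D + 2"] obtain C2 where
    C2: "\<And>h :: nat list \<Rightarrow> nat set. (\<forall>xs. h xs \<in> Pow {..<?D}) \<longrightarrow>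
      (\<exists>s c. strict_mono_on {..<M} s \<and> s ` {..<M} \<subseteq> {..<C2} \<and>
      (\<forall>xs. sorted_wrt (<) xs \<and> set xs \<subseteq> {..<M} \<and> length xs = ?D + 2 \<longrightarrow> h (map s xs) = c))"
    by blast
  from oriented_subsequence[of C2, where ?'e = 'e] obtain C where
    C: "\<And>v :: nat \<Rightarrow> real ^ 'e.
    (\<forall>xs. sorted_wrt (<) xs \<and> set xs \<subseteq> {..<C} \<and> length xs = CARD('e) \<longrightarrow> rowdet (\<lambda>k. v (xs ! k)) \<noteq> 0) \<longrightarrow>
    (\<exists>s \<epsilon>. strict_mono_on {..<C2} s \<and> s ` {..<C2} \<subseteq> {..<C} \<and> oriented C2 \<epsilon> (v \<circ> s))"
    by blast
  show ?thesis
  proof (intro exI[of _ C] allI impI)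
    fix v :: "nat \<Rightarrow> real ^ 'e"
    assume nz: "\<forall>xs. sorted_wrt (<) xs \<and> set xs \<subseteq> {..<C} \<and> length xs = ?D \<longrightarrow>
      rowdet (\<lambda>k. v (xs ! k)) \<noteq> 0"
    from mp[OF C this] obtain s1 \<epsilon> where
      s1: "strict_mono_on {..<C2} s1" "s1 ` {..<C2} \<subseteq> {..<C}" "oriented C2 \<epsilon> (v \<circ> s1)"
      by (elim exE conjE)
    \<comment> \<open>The colour is the whole set of small levels, so one pass settles all levels
      together.\<close>
    define h where "h = (\<lambda>xs. {l. Suc l < ?D \<and> small_cross_ratio (v \<circ> s1) l xs})"
    have "\<forall>xs. h xs \<in> Pow {..<?D}" by (auto simp: h_def)
    from mp[OF C2 this] obtain s2 c where
      s2: "strict_mono_on {..<M} s2" "s2 ` {..<M} \<subseteq> {..<C2}"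
      and c: "\<forall>xs. sorted_wrt (<) xs \<and> set xs \<subseteq> {..<M} \<and> length xs = ?D + 2 \<longrightarrow> h (map s2 xs) = c"
      by (elim exE conjE)
    define u where "u = v \<circ> s1 \<circ> s2"
    have or: "oriented M \<epsilon> u" unfolding u_def by (rule oriented_comp[OF s1(3) s2])
    have hu: "l \<in> h (map s2 xs) \<longleftrightarrow> small_cross_ratio u l xs"
      if "Suc l < ?D" "length xs = ?D + 2" for l xs
      using that small_cross_ratio_map[of xs l "v \<circ> s1" s2] by (simp add: h_def u_def)
    have "small_cross_ratio u l xs"
      if l: "Suc l < ?D" and xs: "sorted_wrt (<) xs" "set xs \<subseteq> {..<M}" "length xs = ?D + 2" for l xs
    proof -
      obtain ys where ys: "sorted_wrt (<) ys" "set ys \<subseteq> {..<M}" "length ys = ?D + 2" "small_cross_ratio u l ys"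
        using small_cross_ratio_exists[OF l or M] by blast
      have "l \<in> h (map s2 ys)" using hu[OF l ys(3)] ys(4) by blast
      moreover have "h (map s2 ys) = c" "h (map s2 xs) = c" using c ys xs by blast+
      ultimately show ?thesis using hu[OF l xs(3)] by blast
    qed
    then have small: "\<forall>l xs. Suc l < ?D \<and> sorted_wrt (<) xs \<and> set xs \<subseteq> {..<M} \<and> length xs = ?D + 2 \<longrightarrow>
      small_cross_ratio u l xs" by simp
    define x where "x = (\<lambda>i. ?D + i * q)"
    from dominant_functionals[OF or M_def q small]
    obtain f :: "nat \<Rightarrow> real ^ 'e \<Rightarrow> real" where f: "\<forall>j<?D. linear (f j)"
      "\<forall>\<phi>. linear \<phi> \<longrightarrow> (\<exists>y. \<forall>z. \<phi> z = (\<Sum>j<?D. y j * f j z))"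
      "\<forall>i<N + 3. \<forall>j<?D. f j (u (x i)) > 0"
      "\<forall>i i' j. i < i' \<and> i' < N + 3 \<and> Suc j < ?D \<longrightarrow>
        2 ^ q * f (Suc j) (u (x i)) * f j (u (x i')) \<le> f j (u (x i)) * f (Suc j) (u (x i'))"
      unfolding x_def by (elim exE conjE)
    define s where "s = s1 \<circ> s2 \<circ> x"
    have us: "u (x i) = v (s i)" for i by (simp add: u_def s_def)
    have x: "x ` {..<N} \<subseteq> {..<M}"
    proof (rule image_subsetI)
      fix i assume "i \<in> {..<N}"
      then have "i * q \<le> N * q" by simp
      moreover have "0 < 3 * q" using q by simp
      moreover have "M = 2 * ?D + (N * q + 3 * q)" by (simp add: M_def add_mult_distrib)
      ultimately have "?D + i * q < M" by linarith
      then show "x i \<in> {..<M}" by (simp add: x_def)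
    qed
    have injx: "inj_on x {..<N}" using q by (auto simp: x_def inj_on_def)
    have "inj_on s2 (x ` {..<N})" using s2(1) x by (meson inj_on_subset strict_mono_on_imp_inj_on)
    then have inj2: "inj_on (s2 \<circ> x) {..<N}" using injx by (intro comp_inj_on)
    have sub2: "(s2 \<circ> x) ` {..<N} \<subseteq> {..<C2}" using x s2(2) by (auto simp: image_subset_iff)
    have "inj_on s1 ((s2 \<circ> x) ` {..<N})" using s1(1) sub2 by (meson inj_on_subset strict_mono_on_imp_inj_on)
    from comp_inj_on[OF inj2 this] have "inj_on s {..<N}" by (simp add: s_def comp_assoc)
    moreover have "s ` {..<N} \<subseteq> {..<C}" using sub2 s1(2) by (auto simp: image_subset_iff s_def)
    ultimately show "\<exists>s (f :: nat \<Rightarrow> real ^ 'e \<Rightarrow> real). inj_on s {..<N} \<and> s ` {..<N} \<subseteq> {..<C} \<and>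
      (\<forall>j<?D. linear (f j)) \<and>
      (\<forall>\<phi>. linear \<phi> \<longrightarrow> (\<exists>y. \<forall>z. \<phi> z = (\<Sum>j<?D. y j * f j z))) \<and>
      (\<forall>i<N. \<forall>j<?D. f j (v (s i)) > 0) \<and>
      (\<forall>i i' j. i < i' \<and> i' < N \<and> Suc j < ?D \<longrightarrow>
        2 ^ q * f (Suc j) (v (s i)) * f j (v (s i')) \<le> f j (v (s i)) * f (Suc j) (v (s i')))"
      using f unfolding us by (intro exI[of _ s] exI[of _ f]) simp
  qed
qed

section \<open>General position\<close>

text \<open>Homogeneous coordinates: affine functions of \<open>x\<close> are the linear functionals
  of \<open>lift x\<close>, and \<open>None\<close> is the extra coordinate.\<close>

definition lift :: "real ^ 'd::finite \<Rightarrow> real ^ 'd option" where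
  "lift x = (\<chi> i. case i of None \<Rightarrow> 1 | Some k \<Rightarrow> x $ k)"

lemma lift_nth [simp]: "lift x $ None = 1" "lift x $ Some k = x $ k"
  by (simp_all add: lift_def)

text \<open>General position excludes only flats of dimension exactly \<open>k - 2\<close>, whereas
  a dependent \<open>S\<close> may span less. An affine basis \<open>B\<close> of \<open>S\<close>
  with one further point of \<open>S\<close> has the right dimension.\<close>

lemma affine_independent_if_general_position:
  fixes P :: "(real ^ 'd) set"
  assumes "general_position P" "S \<subseteq> P" "card S \<le> CARD('d) + 1"
  shows "\<not> affine_dependent S"
proof
  assume dep: "affine_dependent S"
  have finS: "finite S" using assms(1,2) finite_subset unfolding general_position_def by blast
  obtain B where B: "\<not> affine_dependent B" "B \<subseteq> S" "affine hull B = affine hull S"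
    using affine_basis_exists by blast
  then have "B \<noteq> S" using dep by blast
  then obtain x where x: "x \<in> S" "x \<notin> B" using B(2) by blast
  have finB: "finite B" using B(2) finS by (rule finite_subset)
  have cx: "card (insert x B) = card B + 1" using x finB by simp
  have "aff_dim (affine hull B) = int (card B) - 1" using B(1) by (simp add: aff_dim_affine_independent)
  then have "aff_dim (affine hull B) = int (card (insert x B)) - 2" using cx by simp
  moreover have "insert x B \<subseteq> affine hull B"
    using B(2,3) x(1) hull_subset[of S affine] by blast
  moreover have "card (insert x B) \<le> CARD('d) + 1"
    using card_mono[OF finS, of "insert x B"] x B(2) assms(3) by auto
  moreover have "insert x B \<subseteq> P" using x B(2) assms(2) by blast
  ultimately show False
    using assms(1) affine_affine_hull[of B] unfolding general_position_def by blast
qed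

lemma rowdet_lift_nonzero:
  fixes p :: "nat \<Rightarrow> real ^ 'd"
  assumes gp: "general_position P" and p: "inj_on p {..<C}" "p ` {..<C} \<subseteq> P"
    and xs: "distinct xs" "set xs \<subseteq> {..<C}" "length xs = CARD('d option)"
  shows "rowdet (\<lambda>k. lift (p (xs ! k))) \<noteq> 0"
proof
  define pt where "pt = (\<lambda>i :: 'd option. p (xs ! row_index i))"
  assume "rowdet (\<lambda>k. lift (p (xs ! k))) = 0"
  then have "\<not> invertible (\<chi> i. lift (pt i))" by (simp add: rowdet_def invertible_det_nz pt_def)
  then obtain c i0 where c: "(\<Sum>i\<in>UNIV. c i *s row i (\<chi> i. lift (pt i))) = 0" "c i0 \<noteq> 0"
    unfolding invertible_right_inverse matrix_right_invertible_independent_rows by blast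
  have comp: "(\<Sum>i\<in>UNIV. c i * lift (pt i) $ k) = 0" for k
    using arg_cong[OF c(1), of "\<lambda>x. x $ k"] by (simp add: row_def)
  \<comment> \<open>The coordinate \<open>None\<close> turns the linear relation into an affine
    one.\<close>
  have c0: "(\<Sum>i\<in>UNIV. c i) = 0" using comp[of None] by simp
  have cp: "(\<Sum>i\<in>UNIV. c i *\<^sub>R pt i) = 0"
    using comp[of "Some _"] by (simp add: vec_eq_iff)
  have row: "row_index i < length xs" for i :: "'d option"
    using bij_betwE[OF bij_row_index, rule_format, of i] xs(3) by simp
  have inj: "inj pt"
  proof (rule injI)
    fix i j assume "pt i = pt j"
    then have "xs ! row_index i = xs ! row_index j"
      unfolding pt_def using p(1) row xs(2) nth_mem by (metis inj_onD subsetD)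
    then have "row_index i = row_index j" using row xs(1) nth_eq_iff_index_eq by metis
    then show "i = j" using bij_row_index by (metis bij_betw_def injD)
  qed
  have sub: "range pt \<subseteq> P" using row xs(2) p(2) by (auto simp: pt_def subset_iff image_subset_iff)
  have "\<exists>U. sum U (range pt) = 0 \<and> (\<exists>v\<in>range pt. U v \<noteq> 0) \<and> (\<Sum>v\<in>range pt. U v *\<^sub>R v) = 0"
    using c0 cp c(2) inj
    by (intro exI[of _ "c \<circ> inv pt"]) (auto simp: sum.reindex)
  then have "affine_dependent (range pt)"
    by (subst affine_dependent_explicit_finite) simp_all
  moreover have "card (range pt) \<le> CARD('d) + 1" using card_image_le[of UNIV pt] by simp
  ultimately show False using affine_independent_if_general_position[OF gp sub] by blast
qed

lemma linear_lift_affine: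
  fixes g :: "real ^ ('d::finite) option \<Rightarrow> real"
  assumes "linear g"
  shows "g (lift x) = g (axis None 1) + (\<chi> k. g (axis (Some k) 1)) \<bullet> x"
proof -
  have "lift x = axis None 1 + (\<Sum>k\<in>UNIV. x $ k *\<^sub>R axis (Some k) 1)"
  proof (subst vec_eq_iff, rule allI)
    fix i :: "'d option"
    show "lift x $ i = (axis None 1 + (\<Sum>k\<in>UNIV. x $ k *\<^sub>R axis (Some k) 1)) $ i"
      by (cases i) (simp_all add: axis_def if_distrib[of "(*) _"] cong: if_cong)
  qed
  then have "g (lift x) = g (axis None 1) + (\<Sum>k\<in>UNIV. x $ k * g (axis (Some k) 1))"
    by (simp add: linear_add[OF assms] linear_sum[OF assms] linear_scale[OF assms])
  then show ?thesis by (simp add: inner_vec_def mult.commute)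
qed

lemma stretched_subset:
  fixes N :: nat
  shows "\<exists>C. \<forall>P :: (real ^ 'd) set. general_position P \<and> card P \<ge> C \<longrightarrow>
    (\<exists>p f K. inj_on p {..<N} \<and> p ` {..<N} \<subseteq> P \<and> stretched p N (Suc CARD('d)) f K)"
proof -
  define D where "D = Suc CARD('d)"
  have D: "CARD('d option) = D" by (simp add: D_def card_UNIV_option)
  \<comment> \<open>\<open>K\<close> will be \<open>2 ^ q\<close>, so this meets both lower bounds
    on \<open>K\<close> at once.\<close>
  obtain q0 where q0: "(real N)\<^sup>2 + real D * (real N + 1) ^ (3 * D) < 2 ^ q0"
    using real_arch_pow[of 2] by force
  define q where "q = Suc q0"
  have q: "(real N)\<^sup>2 + real D * (real N + 1) ^ (3 * D) < 2 ^ q" "q > 0"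
    using q0 by (auto simp: q_def intro: less_trans)
  obtain C where C: "\<And>v :: nat \<Rightarrow> real ^ 'd option.
    (\<forall>xs. sorted_wrt (<) xs \<and> set xs \<subseteq> {..<C} \<and> length xs = D \<longrightarrow> rowdet (\<lambda>k. v (xs ! k)) \<noteq> 0) \<longrightarrow>
    (\<exists>s (f :: nat \<Rightarrow> real ^ 'd option \<Rightarrow> real). inj_on s {..<N} \<and> s ` {..<N} \<subseteq> {..<C} \<and> (\<forall>j<D. linear (f j)) \<and>
      (\<forall>\<phi>. linear \<phi> \<longrightarrow> (\<exists>y. \<forall>z. \<phi> z = (\<Sum>j<D. y j * f j z))) \<and>
      (\<forall>i<N. \<forall>j<D. f j (v (s i)) > 0) \<and>
      (\<forall>i i' j. i < i' \<and> i' < N \<and> Suc j < D \<longrightarrow>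
        2 ^ q * f (Suc j) (v (s i)) * f j (v (s i')) \<le> f j (v (s i)) * f (Suc j) (v (s i'))))"
    using dominated_subsequence[OF q(2), where ?'e = "'d option" and N = N] unfolding D by (elim exE) (rule that, erule spec)
  show ?thesis
  proof (intro exI[of _ C] allI impI)
    fix P :: "(real ^ 'd) set" assume P: "general_position P \<and> card P \<ge> C"
    then have "finite P" by (simp add: general_position_def)
    then obtain a where a: "bij_betw a {0..<card P} P" using ex_bij_betw_nat_finite by blast
    have a': "inj_on a {..<C}" "a ` {..<C} \<subseteq> P"
      using a P by (auto simp: bij_betw_def inj_on_def)
    have "\<forall>xs. sorted_wrt (<) xs \<and> set xs \<subseteq> {..<C} \<and> length xs = D \<longrightarrow> rowdet (\<lambda>k. lift (a (xs ! k))) \<noteq> 0"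
      using rowdet_lift_nonzero[OF conjunct1[OF P] a'] D by (simp add: strict_sorted_iff)
    from mp[OF C this] obtain s and f :: "nat \<Rightarrow> real ^ 'd option \<Rightarrow> real" where s: "inj_on s {..<N}" "s ` {..<N} \<subseteq> {..<C}"
      and lin: "\<forall>j<D. linear (f j)"
      and spanning: "\<forall>\<phi>. linear \<phi> \<longrightarrow> (\<exists>y. \<forall>z. \<phi> z = (\<Sum>j<D. y j * f j z))"
      and pos: "\<forall>i<N. \<forall>j<D. f j (lift (a (s i))) > 0"
      and dom: "\<forall>i i' j. i < i' \<and> i' < N \<and> Suc j < D \<longrightarrow> 2 ^ q * f (Suc j) (lift (a (s i))) * f j (lift (a (s i')))
        \<le> f j (lift (a (s i))) * f (Suc j) (lift (a (s i')))"
      by (elim exE conjE)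
    have "stretched (a \<circ> s) N D (\<lambda>j x. f j (lift x)) (2 ^ q)"
    proof
      show "\<exists>c b. \<forall>x. f j (lift x) = c + b \<bullet> x" if "j < D" for j
        using linear_lift_affine lin that by blast
      show "\<exists>y. \<forall>x. c + b \<bullet> x = (\<Sum>j<D. y j * f j (lift x))" for c and b :: "real ^ 'd"
      proof -
        define \<phi> where "\<phi> = (\<lambda>z :: real ^ 'd option. c * z $ None + (\<Sum>k\<in>UNIV. b $ k * z $ Some k))"
        have "linear \<phi>"
          by (intro linearI)
            (simp_all add: \<phi>_def algebra_simps sum.distrib sum_distrib_left)
        moreover have "\<phi> (lift x) = c + b \<bullet> x" for x by (simp add: \<phi>_def inner_vec_def)
        ultimately show ?thesis using spanning by metis
      qed
      show "(real N)\<^sup>2 < 2 ^ q" "real D * (real N + 1) ^ (3 * D) < 2 ^ q"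
        using q(1) zero_le_power2[of "real N"] by (simp_all add: add_increasing order.strict_trans1[rotated])
    qed (use pos dom in \<open>auto simp: D_def\<close>)
    moreover have "inj_on (a \<circ> s) {..<N}" using s a'(1) by (intro comp_inj_on) (auto intro: inj_on_subset)
    moreover have "(a \<circ> s) ` {..<N} \<subseteq> P" using s(2) a'(2) by (auto simp: image_subset_iff)
    ultimately show "\<exists>p f K. inj_on p {..<N} \<and> p ` {..<N} \<subseteq> P \<and> stretched p N (Suc CARD('d)) f K"
      unfolding D_def by blast
  qed
qed

lemma general_position_subset:
  fixes P :: "(real ^ 'd) set"
  assumes "general_position P" "S \<subseteq> P"
  shows "general_position S"
  unfolding general_position_def
proof (intro conjI allI impI)
  show "finite S" using assms finite_subset unfolding general_position_def by blast
  fix k T assume k: "k \<le> CARD('d) + 1" and T: "T \<subseteq> S \<and> card T = k"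
  have "T \<subseteq> P" using T assms(2) by (meson subset_trans)
  with T assms(1) k show "\<not> (\<exists>A. affine A \<and> aff_dim A = int k - 2 \<and> T \<subseteq> A)"
    unfolding general_position_def by simp
qed

text \<open>Without such sets the weak Tverberg property could hold vacuously. On the moment curve
  an affine dependence \<open>U\<close> annihilates every polynomial of degree at most
  \<open>CARD('d)\<close> in the parameter; one with roots at all points except \<open>v\<close>
  gives \<open>U v = 0\<close>.\<close>

lemma general_position_exists: "\<exists>P :: (real ^ 'd) set. general_position P \<and> card P = n"
proof -
  define mc where "mc = (\<lambda>t. (\<chi> k. real t ^ Suc (row_index k)) :: real ^ 'd)"
  have "0 < CARD('d)" by simp
  then obtain k0 :: 'd where k0: "row_index k0 = 0"
    using bij_row_index by (metis bij_betw_iff_bijections lessThan_iff)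
  have \<tau>: "mc t $ k0 = real t" for t by (simp add: mc_def k0)
  have inj: "inj mc" by (rule injI) (metis \<tau> of_nat_eq_iff)
  have indep: "\<not> affine_dependent S" if S: "S \<subseteq> range mc" "finite S" "card S \<le> CARD('d) + 1" for S
  proof
    assume "affine_dependent S"
    then obtain U v where U: "sum U S = 0" "(\<Sum>x\<in>S. U x *\<^sub>R x) = 0" and v: "v \<in> S" "U v \<noteq> 0"
      unfolding affine_dependent_explicit_finite[OF S(2)] by blast
    have pw: "(\<Sum>x\<in>S. U x * (x $ k0) ^ i) = 0" if "i \<le> CARD('d)" for i
    proof (cases i)
      case (Suc m)
      then have "m < CARD('d)" using that by simp
      then obtain k :: 'd where k: "row_index k = m"
        using bij_row_index by (metis bij_betw_iff_bijections lessThan_iff)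
      have "x $ k = (x $ k0) ^ i" if "x \<in> S" for x
        using S(1) that k k0 Suc by (auto simp: mc_def)
      then have "(\<Sum>x\<in>S. U x * (x $ k0) ^ i) = (\<Sum>x\<in>S. U x *\<^sub>R x) $ k" by simp
      then show ?thesis using U(2) by simp
    qed (use U in simp)
    define Q where "Q = (\<Prod>y\<in>S - {v}. [:- (y $ k0), 1:])"
    have deg: "degree Q \<le> CARD('d)"
    proof -
      have "degree Q \<le> (\<Sum>y\<in>S - {v}. degree [:- (y $ k0), 1:])"
        unfolding Q_def using S(2) degree_prod_sum_le[of "S - {v}" "\<lambda>y. [:- (y $ k0), 1:]"]
        by (simp add: o_def)
      also have "\<dots> = card S - 1" using S(2) v by simp
      finally show ?thesis using S(3) by simp
    qed
    have "(\<Sum>x\<in>S. U x * poly Q (x $ k0)) = (\<Sum>x\<in>S. \<Sum>i\<le>degree Q. coeff Q i * (U x * (x $ k0) ^ i))"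
      by (simp add: poly_altdef sum_distrib_left mult_ac)
    also have "\<dots> = (\<Sum>i\<le>degree Q. coeff Q i * (\<Sum>x\<in>S. U x * (x $ k0) ^ i))"
      by (subst sum.swap) (simp add: sum_distrib_left)
    also have "\<dots> = 0" using pw deg by (intro sum.neutral) simp
    finally have "(\<Sum>x\<in>S. U x * poly Q (x $ k0)) = 0" .
    moreover have "poly Q (x $ k0) = 0" if "x \<in> S - {v}" for x
      unfolding Q_def poly_prod using that S(2) by (intro prod_zero) auto
    then have "(\<Sum>x\<in>S. U x * poly Q (x $ k0)) = U v * poly Q (v $ k0)"
      using S(2) v by (simp add: sum.remove[of S v])
    moreover have "poly Q (v $ k0) \<noteq> 0"
    proof -
      have "v $ k0 \<noteq> y $ k0" if "y \<in> S - {v}" for y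
      proof -
        have "v \<in> range mc" "y \<in> range mc" "v \<noteq> y" using that v(1) S(1) by blast+
        then show ?thesis using \<tau> by auto
      qed
      then show ?thesis using S(2) by (simp add: Q_def poly_prod)
    qed
    ultimately show False using v by simp
  qed
  have "general_position (mc ` {..<n})"
    unfolding general_position_def
  proof (intro conjI allI impI notI)
    fix k S assume k: "k \<le> CARD('d) + 1" and S: "S \<subseteq> mc ` {..<n} \<and> card S = k"
      and "\<exists>A. affine A \<and> aff_dim A = int k - 2 \<and> S \<subseteq> A"
    then obtain A where "aff_dim A = int k - 2" "S \<subseteq> A" by blast
    then have "aff_dim S \<le> int k - 2" using aff_dim_subset by metis
    moreover have "finite S" using S finite_subset by blast
    then have "\<not> affine_dependent S" using indep[of S] S k by blast
    then have "aff_dim S = int k - 1" using aff_dim_affine_independent[of S] S by simp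
    ultimately show False by simp
  qed simp
  moreover have "card (mc ` {..<n}) = n" using inj by (simp add: card_image inj_on_subset)
  ultimately show ?thesis by blast
qed

section \<open>The characterization\<close>

lemma set_colorful_word:
  assumes "colorful_word d \<sigma> V"
  shows "set V = \<sigma>"
proof
  show "set V \<subseteq> \<sigma>" using assms by (simp add: colorful_word_def)
  show "\<sigma> \<subseteq> set V"
  proof
    fix a assume "a \<in> \<sigma>"
    moreover have "1 \<in> {1..d + 1}" by simp
    ultimately have "count_list (take (card \<sigma>) (drop ((1 - 1) * (card \<sigma> - 1)) V)) a = 1"
      using assms unfolding colorful_word_def by blast
    then have "a \<in> set (take (card \<sigma>) V)" using count_notin[of a "take (card \<sigma>) V"] by auto
    then show "a \<in> set V" by (rule in_set_takeD)
  qed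
qed

text \<open>A letter that occurs only once can only be the common endpoint of the first two intervals of a
  chain. Hence appending such letters creates no new colorful subwords.\<close>

lemma covering_chain_append_new_letters:
  assumes e: "covering_chain D \<sigma> (W @ us) e" and D: "D \<ge> 2" and r: "card \<sigma> \<ge> 2"
    and us: "distinct us" "set us \<inter> set W = {}"
  shows "\<sigma> \<inter> set us = {}"
proof (rule ccontr)
  assume "\<not> ?thesis"
  then obtain x where x: "x \<in> \<sigma>" "x \<in> set us" by blast
  have uniq: "k = l"
    if "k < length (W @ us)" "l < length (W @ us)" "(W @ us) ! k = (W @ us) ! l" "(W @ us) ! k \<in> set us" for k l
  proof -
    have ge: "\<not> i < length W" if "(W @ us) ! i \<in> set us" for i
      using that us(2) by (auto simp: nth_append)
    have "length W \<le> k" "length W \<le> l" using ge[of k] ge[of l] that by simp_all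
    moreover from this have "us ! (k - length W) = us ! (l - length W)" using that by (simp add: nth_append)
    ultimately have "k - length W = l - length W"
      using us(1) that(1,2) by (subst (asm) nth_eq_iff_index_eq) auto
    then show ?thesis using \<open>length W \<le> k\<close> \<open>length W \<le> l\<close> by simp
  qed
  have c1: "\<sigma> \<subseteq> letters_between (W @ us) (e 0) (e 1)" and c2: "\<sigma> \<subseteq> letters_between (W @ us) (e 1) (e 2)"
    using e D unfolding covering_chain_def by (auto simp: numeral_2_eq_2)
  have occ: "\<exists>k l. k \<le> e 1 \<and> e 1 \<le> l \<and> k < length (W @ us) \<and> l < length (W @ us) \<and>
    (W @ us) ! k = y \<and> (W @ us) ! l = y" if y: "y \<in> \<sigma>" for y
  proof -
    obtain k l where "k \<le> e 1" "k < length (W @ us)" "(W @ us) ! k = y"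
      "e 1 \<le> l" "l < length (W @ us)" "(W @ us) ! l = y"
      using subsetD[OF c1 y] subsetD[OF c2 y] by (auto simp: letters_between_def)
    then show ?thesis by (intro exI[of _ k] exI[of _ l]) simp
  qed
  have e1: "(W @ us) ! e 1 = y" if y: "y \<in> \<sigma>" "y \<in> set us" for y
  proof -
    obtain k l where kl: "k \<le> e 1" "e 1 \<le> l" "k < length (W @ us)" "l < length (W @ us)"
      "(W @ us) ! k = y" "(W @ us) ! l = y" using occ[OF y(1)] by blast
    then have "k = l" using uniq[of k l] y(2) by simp
    then show ?thesis using kl by simp
  qed
  \<comment> \<open>A second letter \<open>y\<close> of \<sigma> occurs at or after
    \<open>e 1\<close>, where only new letters stand; so \<open>y\<close> is new and also sits at
    \<open>e 1\<close>, the place of \<open>x\<close>.\<close>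
  have "\<not> \<sigma> \<subseteq> {x}" using r card_mono[of "{x}" \<sigma>] by auto
  then obtain y where y: "y \<in> \<sigma>" "y \<noteq> x" by blast
  obtain l where l: "e 1 \<le> l" "l < length (W @ us)" "(W @ us) ! l = y" using occ[OF y(1)] by blast
  have "length W \<le> e 1"
  proof (rule ccontr)
    assume lt: "\<not> ?thesis"
    then have "(W @ us) ! e 1 \<in> set W" by (simp add: nth_append)
    then show False using e1[OF x] x(2) us(2) by auto
  qed
  then have "y \<in> set us" using l by (auto simp: nth_append)
  then show False using e1[OF x] e1[OF y(1)] y(2) by simp
qed

text \<open>A representing word may contain non-vertices and may lack vertices. Deleting the former
  harms no face, and the latter are appended once each; that this adds no colorful subword is where
  \<open>d \<ge> 1\<close> enters, through two intervals with a common end.\<close>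

lemma colorfully_representable_normal_form:
  assumes \<Delta>: "simplicial_complex_on n \<Delta>" and rep: "colorfully_representable d n \<Delta>" and d: "d \<ge> 1"
  shows "\<exists>W. set W = {i \<in> {1..n}. {i} \<in> \<Delta>} \<and>
    (\<forall>\<sigma>. \<sigma> \<subseteq> {1..n} \<and> card \<sigma> \<ge> 2 \<longrightarrow> (\<sigma> \<in> \<Delta> \<longleftrightarrow> (\<exists>V. subseq V W \<and> colorful_word d \<sigma> V)))"
proof -
  obtain W0 where W0: "set W0 \<subseteq> {1..n}"
    "\<And>\<sigma>. \<sigma> \<subseteq> {1..n} \<Longrightarrow> card \<sigma> \<ge> 2 \<Longrightarrow> \<sigma> \<in> \<Delta> \<longleftrightarrow> (\<exists>V. subseq V W0 \<and> colorful_word d \<sigma> V)"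
    using rep unfolding colorfully_representable_def by blast
  define vs where "vs = {i \<in> {1..n}. {i} \<in> \<Delta>}"
  define W where "W = filter (\<lambda>i. i \<in> vs) W0"
  define us where "us = sorted_list_of_set (vs - set W)"
  have "finite vs" by (simp add: vs_def)
  then have us: "distinct us" "set us \<inter> set W = {}" "set us = vs - set W" by (auto simp: us_def)
  have "set (W @ us) = vs" using us(3) by (auto simp: W_def)
  moreover have "\<sigma> \<in> \<Delta> \<longleftrightarrow> (\<exists>V. subseq V (W @ us) \<and> colorful_word d \<sigma> V)"
    if \<sigma>: "\<sigma> \<subseteq> {1..n}" "card \<sigma> \<ge> 2" for \<sigma>
  proof
    assume s: "\<sigma> \<in> \<Delta>"
    then obtain V where V: "subseq V W0" "colorful_word d \<sigma> V" using W0(2)[OF \<sigma>] by blast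
    have "\<sigma> \<subseteq> vs" using s \<sigma>(1) \<Delta> unfolding simplicial_complex_on_def vs_def by blast
    then have "filter (\<lambda>i. i \<in> vs) V = V" using set_colorful_word[OF V(2)] by (auto simp: filter_id_conv)
    then have "subseq V W" unfolding W_def using subseq_filter[OF V(1)] by metis
    then show "\<exists>V. subseq V (W @ us) \<and> colorful_word d \<sigma> V"
      using V(2) subseq_rev_drop_many by blast
  next
    assume "\<exists>V. subseq V (W @ us) \<and> colorful_word d \<sigma> V"
    then obtain V where V: "subseq V (W @ us)" "colorful_word d \<sigma> V" by blast
    obtain e where "covering_chain (Suc d) \<sigma> (W @ us) e"
      using covering_chain_if_colorful[OF V \<sigma>(2)] by blast
    from covering_chain_append_new_letters[OF this _ \<sigma>(2) us(1,2)] d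
    have "\<sigma> \<inter> set us = {}" by simp
    then have "filter (\<lambda>i. i \<notin> set us) V = V" using set_colorful_word[OF V(2)] by (auto simp: filter_id_conv)
    moreover have "filter (\<lambda>i. i \<notin> set us) (W @ us) = W" using us(2) by (auto simp: filter_id_conv filter_empty_conv)
    ultimately have "subseq V W" using subseq_filter[OF V(1), of "\<lambda>i. i \<notin> set us"] by metis
    moreover have "subseq W W0" by (simp add: W_def)
    ultimately have "subseq V W0" by (rule subseq_order.order_trans)
    then show "\<sigma> \<in> \<Delta>" using W0(2)[OF \<sigma>] V(2) by blast
  qed
  ultimately show ?thesis unfolding vs_def by blast
qed

text \<open>A complex is induced on a mere subset of the given points, so the structure must pass to
  subsequences, with the same \<open>f\<close> and \<open>K\<close>.\<close>

lemma (in stretched) stretched_comp: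
  assumes s: "strict_mono_on {..<M} s" "s ` {..<M} \<subseteq> {..<N}"
  shows "stretched (p \<circ> s) M D f K"
proof
  have sN: "s i < N" if "i < M" for i using s(2) that by auto
  have MN: "M \<le> N"
    using card_mono[OF _ s(2)] card_image[OF strict_mono_on_imp_inj_on[OF s(1)]] by simp
  show "0 < f j ((p \<circ> s) i)" if "i < M" "j < D" for i j using pos sN that by simp
  show "K * f (Suc j) ((p \<circ> s) i) * f j ((p \<circ> s) i') \<le> f j ((p \<circ> s) i) * f (Suc j) ((p \<circ> s) i')"
    if "i < i'" "i' < M" "Suc j < D" for i i' j
    using dominance[of "s i" "s i'" j] strict_mono_onD[OF s(1), of i i'] sN that by simp
  have "(real M)\<^sup>2 \<le> (real N)\<^sup>2" using MN by (intro power_mono) auto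
  then show "(real M)\<^sup>2 < K" using K_gt_square by linarith
  have "real D * (real M + 1) ^ (3 * D) \<le> real D * (real N + 1) ^ (3 * D)"
    using MN by (intro mult_left_mono power_mono) auto
  then show "real D * (real M + 1) ^ (3 * D) < K" using K_gt_power by linarith
qed (use affine_f spanning D_pos in auto)

theorem theorem1p4:
  fixes n :: nat and \<Delta> :: "nat set set"
  assumes "simplicial_complex_on n \<Delta>"
  shows "weakly_Tverberg TYPE('d::finite) n \<Delta> \<longleftrightarrow> colorfully_representable CARD('d) n \<Delta>"
proof
  assume "weakly_Tverberg TYPE('d) n \<Delta>"
  then obtain C where C: "\<And>P :: (real ^ 'd) set. general_position P \<Longrightarrow> card P \<ge> C \<Longrightarrow>
    \<exists>P' \<subseteq> P. partition_induced_on n \<Delta> P'"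
    unfolding weakly_Tverberg_def by blast
  \<comment> \<open>The hypothesis is applied to a stretched set of exactly \<open>C\<close> points,
    so that all points it selects are stretched; \<open>m\<close> is the size needed to extract such
    a set.\<close>
  obtain m where m: "\<forall>P :: (real ^ 'd) set. general_position P \<and> card P \<ge> m \<longrightarrow>
    (\<exists>p f K. inj_on p {..<C} \<and> p ` {..<C} \<subseteq> P \<and> stretched p C (Suc CARD('d)) f K)"
    using stretched_subset[of C] by blast
  obtain P0 :: "(real ^ 'd) set" where P0: "general_position P0" "card P0 = m"
    using general_position_exists by blast
  obtain p f K where p: "inj_on p {..<C}" "p ` {..<C} \<subseteq> P0" and st: "stretched p C (Suc CARD('d)) f K"
    using m P0 by blast
  have "general_position (p ` {..<C})" using P0(1) p(2) by (rule general_position_subset)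
  moreover have "card (p ` {..<C}) = C" using p(1) by (simp add: card_image)
  ultimately obtain P' where P': "P' \<subseteq> p ` {..<C}" "partition_induced_on n \<Delta> P'" using C[of "p ` {..<C}"] by auto
  then obtain Q where Q: "(\<Union>i\<in>{1..n}. Q i) = P'" "disjoint_family_on Q {1..n}"
    "\<And>\<sigma>. \<sigma> \<subseteq> {1..n} \<Longrightarrow> (\<Inter>i\<in>\<sigma>. convex hull (Q i)) \<noteq> {} \<longleftrightarrow> \<sigma> \<in> \<Delta>"
    unfolding partition_induced_on_def by blast
  define I where "I = {k. k < C \<and> p k \<in> P'}"
  define ks where "ks = sorted_list_of_set I"
  have ks: "set ks = I" "sorted_wrt (<) ks" by (simp_all add: ks_def I_def)
  define col where "col = (\<lambda>x. SOME i. i \<in> {1..n} \<and> x \<in> Q i)"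
  have col: "col x \<in> {1..n} \<and> x \<in> Q (col x)" if "x \<in> P'" for x
  proof -
    have "\<exists>i. i \<in> {1..n} \<and> x \<in> Q i" using that Q(1) by blast
    then show ?thesis unfolding col_def by (rule someI_ex)
  qed
  have col_eq: "col x = i" if "i \<in> {1..n}" "x \<in> Q i" for x i
  proof (rule ccontr)
    assume ne: "col x \<noteq> i"
    have "x \<in> P'" using that Q(1) by blast
    then have "col x \<in> {1..n}" "x \<in> Q (col x)" using col by blast+
    then show False using Q(2) that ne unfolding disjoint_family_on_def by blast
  qed
  define W where "W = map (\<lambda>k. col (p k)) ks"
  define N where "N = length ks"
  interpret st: stretched p C "Suc CARD('d)" f K by (fact st)
  interpret st': stretched "p \<circ> (!) ks" N "Suc CARD('d)" f K
  proof (rule st.stretched_comp)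
    show "strict_mono_on {..<N} ((!) ks)"
      using sorted_wrt_nth_less[OF ks(2)] by (auto simp: strict_mono_on_def N_def)
    show "(!) ks ` {..<N} \<subseteq> {..<C}"
      using nth_mem[of _ ks] ks(1) by (auto simp: I_def N_def)
  qed
  have Qc: "(p \<circ> (!) ks) ` {k. k < N \<and> W ! k = c} = Q c" if c: "c \<in> {1..n}" for c
  proof
    show "(p \<circ> (!) ks) ` {k. k < N \<and> W ! k = c} \<subseteq> Q c"
    proof (rule image_subsetI)
      fix k assume "k \<in> {k. k < N \<and> W ! k = c}"
      then have k: "k < length ks" "col (p (ks ! k)) = c" by (auto simp: N_def W_def)
      then have "p (ks ! k) \<in> P'" using nth_mem[of k ks] ks(1) by (simp add: I_def)
      then show "(p \<circ> (!) ks) k \<in> Q c" using col k(2) by auto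
    qed
    show "Q c \<subseteq> (p \<circ> (!) ks) ` {k. k < N \<and> W ! k = c}"
    proof
      fix x assume x: "x \<in> Q c"
      then have "x \<in> P'" using Q(1) c by blast
      then obtain k where k: "k < C" "x = p k" using P'(1) by blast
      then have "k \<in> set ks" using \<open>x \<in> P'\<close> ks(1) by (simp add: I_def)
      then obtain i where i: "i < length ks" "ks ! i = k" by (auto simp: in_set_conv_nth)
      then have "W ! i = c" using col_eq[OF c x] k by (simp add: W_def)
      then show "x \<in> (p \<circ> (!) ks) ` {k. k < N \<and> W ! k = c}"
        using i k by (intro image_eqI[of _ _ i]) (simp_all add: N_def)
    qed
  qed
  show "colorfully_representable CARD('d) n \<Delta>"
    unfolding colorfully_representable_def
  proof (intro exI[of _ W] conjI allI impI)
    show "set W \<subseteq> {1..n}" using col ks(1) by (auto simp: W_def I_def)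
    fix \<sigma> assume \<sigma>: "\<sigma> \<subseteq> {1..n} \<and> 2 \<le> card \<sigma>"
    have "\<sigma> \<in> \<Delta> \<longleftrightarrow> (\<Inter>c\<in>\<sigma>. convex hull (Q c)) \<noteq> {}" using Q(3) \<sigma> by blast
    also have "(\<Inter>c\<in>\<sigma>. convex hull (Q c)) = (\<Inter>c\<in>\<sigma>. convex hull ((p \<circ> (!) ks) ` {k. k < N \<and> W ! k = c}))"
      using Qc \<sigma> by (intro INF_cong refl) (simp add: subset_iff)
    also have "\<dots> \<noteq> {} \<longleftrightarrow> (\<exists>V. subseq V W \<and> colorful_word CARD('d) \<sigma> V)"
      using \<sigma> by (intro st'.common_point_iff_colorful_subword) (simp_all add: W_def N_def)
    finally show "\<sigma> \<in> \<Delta> \<longleftrightarrow> (\<exists>V. subseq V W \<and> colorful_word CARD('d) \<sigma> V)" .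
  qed
next
  assume rep: "colorfully_representable CARD('d) n \<Delta>"
  have "CARD('d) \<ge> 1" by (simp add: Suc_le_eq)
  from colorfully_representable_normal_form[OF assms rep this] obtain W where
    W: "set W = {i \<in> {1..n}. {i} \<in> \<Delta>}" and
    colorful: "\<And>\<sigma>. \<sigma> \<subseteq> {1..n} \<Longrightarrow> card \<sigma> \<ge> 2 \<Longrightarrow> \<sigma> \<in> \<Delta> \<longleftrightarrow> (\<exists>V. subseq V W \<and> colorful_word CARD('d) \<sigma> V)"
    by blast
  define N where "N = length W"
  obtain C where C: "\<forall>P :: (real ^ 'd) set. general_position P \<and> card P \<ge> C \<longrightarrow>
    (\<exists>p f K. inj_on p {..<N} \<and> p ` {..<N} \<subseteq> P \<and> stretched p N (Suc CARD('d)) f K)"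
    using stretched_subset[of N] by blast
  have "\<exists>P'\<subseteq>P. partition_induced_on n \<Delta> P'" if P: "general_position P \<and> card P \<ge> C" for P :: "(real ^ 'd) set"
  proof -
    obtain p f K where p: "inj_on p {..<N}" "p ` {..<N} \<subseteq> P" and st: "stretched p N (Suc CARD('d)) f K"
      using C P by blast
    interpret stretched p N "Suc CARD('d)" f K by (fact st)
    define Q where "Q = (\<lambda>c. p ` {k. k < N \<and> W ! k = c})"
    have "(\<Union>c\<in>{1..n}. Q c) = p ` {..<N}"
    proof -
      have "p k \<in> (\<Union>c\<in>{1..n}. Q c)" if "k < N" for k
      proof (rule UN_I)
        show "W ! k \<in> {1..n}" using that W nth_mem[of k W] by (auto simp: N_def)
        show "p k \<in> Q (W ! k)" using that by (simp add: Q_def)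
      qed
      moreover have "Q c \<subseteq> p ` {..<N}" for c by (auto simp: Q_def)
      ultimately show ?thesis by blast
    qed
    moreover have "disjoint_family_on Q {1..n}"
      using p(1) by (auto simp: disjoint_family_on_def Q_def inj_on_def)
    moreover have "(\<Inter>c\<in>\<sigma>. convex hull (Q c)) \<noteq> {} \<longleftrightarrow> \<sigma> \<in> \<Delta>" if \<sigma>: "\<sigma> \<subseteq> {1..n}" for \<sigma>
    proof -
      have fin: "finite \<sigma>" using \<sigma> finite_subset by blast
      \<comment> \<open>Colorfulness covers only \<open>card \<sigma> \<ge> 2\<close>; singletons
        are settled by the normal form of \<open>W\<close>, and the empty face by
        \<open>{} \<in> \<Delta>\<close>.\<close>
      consider "\<sigma> = {}" | c where "\<sigma> = {c}" | "card \<sigma> \<ge> 2"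
      proof (cases "card \<sigma> \<ge> 2")
        case False
        then have "card \<sigma> = 0 \<or> card \<sigma> = 1" by linarith
        then show ?thesis using that fin by (auto simp: card_1_singleton_iff)
      qed (use that in blast)
      then show ?thesis
      proof cases
        case 1
        then show ?thesis using assms by (simp add: simplicial_complex_on_def)
      next
        case (2 c)
        then have "\<sigma> \<in> \<Delta> \<longleftrightarrow> c \<in> set W" using W \<sigma> by simp
        also have "\<dots> \<longleftrightarrow> Q c \<noteq> {}" by (auto simp: Q_def N_def in_set_conv_nth)
        finally show ?thesis using 2 by simp
      next
        case 3
        then show ?thesis
          unfolding Q_def using colorful[OF \<sigma> 3] common_point_iff_colorful_subword[of "CARD('d)" W \<sigma>]
          by (simp add: N_def)
      qed
    qed
    ultimately have "partition_induced_on n \<Delta> (p ` {..<N})"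
      unfolding partition_induced_on_def by (intro exI[of _ Q]) simp
    then show ?thesis using p(2) by blast
  qed
  then show "weakly_Tverberg TYPE('d) n \<Delta>" unfolding weakly_Tverberg_def by blast
qed

end
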